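(* Let $p\ge1$ and $n\ge p+1$ be integers. For all indices $r,d$, $$\beta_{r,d}(R/I_p(L_n))=\beta_{r,d}(R/I_p(L_{n-1}))+\beta_{r-1,d-p}(R/I_p(L_{n-(p+1)}))+\beta_{r-2,d-(p+1)}(R/I_p(L_{n-(p+1)})).$$
   Context: $\Bbbk$ is any field. For $k\ge 0$, $L_k$ is the path on the $k$ vertices $x_1,\dots,x_k$, and $I_p(L_k)$ is the ideal generated by the monomials $x_ix_{i+1}\cdots x_{i+p-1}$ with $1\le i\le k-p+1$ (the zero ideal if $k<p$). All these ideals are regarded in the polynomial ring $R=\Bbbk[x_1,\dots,x_n]$. $\beta_{r,d}(R/I)$ is the graded Betti number, i.e. the number of minimal generators of degree $d$ in homological degree $r$ of the minimal graded free resolution of $R/I$ over $R$ (zero when $r<0$ or $d<0$). *)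

theory Defs
  imports
    "HOL-Library.Poly_Mapping"
    "HOL-Algebra.Ideal"
    "Jordan_Normal_Form.Matrix"
begin

text \<open>
  Monomials are exponent vectors \<open>nat \<Rightarrow>\<^sub>0 nat\<close>. The type provides the variables
  \<open>x\<^sub>0, x\<^sub>1, \<dots>\<close>; the polynomial ring in \<open>x\<^sub>1, \<dots>, x\<^sub>n\<close> is the subring \<open>poly_ring n\<close>.
\<close>

type_synonym 'a mpoly = "(nat \<Rightarrow>\<^sub>0 nat) \<Rightarrow>\<^sub>0 'a"

definition poly_ring :: "nat \<Rightarrow> 'a::field mpoly ring" where
  "poly_ring n =
    \<lparr>carrier = {f. \<forall>m\<in>Poly_Mapping.keys f. Poly_Mapping.keys m \<subseteq> {1..n}},
     monoid.mult = (*), one = 1, zero = 0, add = (+)\<rparr>"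

definition var :: "nat \<Rightarrow> 'a::field mpoly" where
  "var i = Poly_Mapping.single (Poly_Mapping.single i 1) 1"

definition mon_degree :: "(nat \<Rightarrow>\<^sub>0 nat) \<Rightarrow> nat" where
  "mon_degree m = (\<Sum>i\<in>Poly_Mapping.keys m. Poly_Mapping.lookup m i)"

text \<open>The zero polynomial is homogeneous of every degree, and the only one in negative degrees.\<close>

definition homogeneous :: "int \<Rightarrow> 'a::field mpoly \<Rightarrow> bool" where
  "homogeneous d f \<longleftrightarrow> (\<forall>m\<in>Poly_Mapping.keys f. int (mon_degree m) = d)"

definition irrelevant_ideal :: "nat \<Rightarrow> 'a::field mpoly set" where
  "irrelevant_ideal n = Idl\<^bsub>poly_ring n\<^esub> (var ` {1..n})"

text \<open>
  The ideal of \<open>k[x\<^sub>1, \<dots>, x\<^sub>n]\<close> attached to the path on \<open>x\<^sub>1, \<dots>, x\<^sub>k\<close>. The bound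
  \<open>i + p \<le> k + 1\<close> is \<open>i \<le> k - p + 1\<close> without truncated subtraction; for \<open>k < p\<close> there are
  no generators.
\<close>

definition path_ideal :: "nat \<Rightarrow> nat \<Rightarrow> nat \<Rightarrow> 'a::field mpoly set" where
  "path_ideal n p k =
    Idl\<^bsub>poly_ring n\<^esub> {\<Prod>j\<in>{i..<i + p}. var j | i. 1 \<le> i \<and> i + p \<le> k + 1}"

definition free_module :: "nat \<Rightarrow> nat \<Rightarrow> 'a::field mpoly vec set" where
  "free_module n m = {v \<in> carrier_vec m. \<forall>j<m. v $ j \<in> carrier (poly_ring n)}"

text \<open>
  A graded free resolution of \<open>R/I\<close> with \<open>R = poly_ring n\<close>, by modules of finite rank.
  The list \<open>s i\<close> holds the degrees of the basis elements of the module in homological degree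
  \<open>i\<close>, so \<open>F\<^sub>i\<close> is the direct sum of the \<open>R(- s i ! j)\<close> over \<open>j < length (s i)\<close>.
  The matrix \<open>D i\<close> represents the differential from \<open>F\<^bsub>i+1\<^esub>\<close> to \<open>F\<^sub>i\<close> in these bases; it is
  homogeneous of degree 0 iff its entry in row \<open>j\<close> and column \<open>l\<close> is homogeneous of degree
  \<open>s (i + 1) ! l - s i ! j\<close>. The augmentation from \<open>F\<^sub>0\<close> to \<open>R/I\<close> sends \<open>v\<close> to the class of
  \<open>e \<bullet> v\<close>, where \<open>e $ j\<close> represents the image of the \<open>j\<close>-th basis element.
\<close>

definition graded_free_resolution ::
    "nat \<Rightarrow> 'a::field mpoly set \<Rightarrow> (nat \<Rightarrow> int list) \<Rightarrow> 'a mpoly vec \<Rightarrow> (nat \<Rightarrow> 'a mpoly mat) \<Rightarrow> bool"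
  where
  "graded_free_resolution n I s e D \<longleftrightarrow>
    e \<in> free_module n (length (s 0)) \<and>
    (\<forall>j<length (s 0). homogeneous (s 0 ! j) (e $ j)) \<and>
    (\<forall>i. D i \<in> carrier_mat (length (s i)) (length (s (Suc i))) \<and>
      (\<forall>j<length (s i). \<forall>l<length (s (Suc i)).
        D i $$ (j, l) \<in> carrier (poly_ring n) \<and>
        homogeneous (s (Suc i) ! l - s i ! j) (D i $$ (j, l)))) \<and>
    (\<forall>f\<in>carrier (poly_ring n). \<exists>v\<in>free_module n (length (s 0)). f - e \<bullet> v \<in> I) \<and>
    {v \<in> free_module n (length (s 0)). e \<bullet> v \<in> I} =
      (\<lambda>w. D 0 *\<^sub>v w) ` free_module n (length (s 1)) \<and>
    (\<forall>i. {v \<in> free_module n (length (s (Suc i))). D i *\<^sub>v v = 0\<^sub>v (length (s i))} =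
      (\<lambda>w. D (Suc i) *\<^sub>v w) ` free_module n (length (s (Suc (Suc i)))))"

text \<open>Minimality: the image of every differential lies in \<open>\<mm> F\<^sub>i\<close>, \<open>\<mm> = (x\<^sub>1, \<dots>, x\<^sub>n)\<close>.\<close>

definition minimal_graded_free_resolution ::
    "nat \<Rightarrow> 'a::field mpoly set \<Rightarrow> (nat \<Rightarrow> int list) \<Rightarrow> 'a mpoly vec \<Rightarrow> (nat \<Rightarrow> 'a mpoly mat) \<Rightarrow> bool"
  where
  "minimal_graded_free_resolution n I s e D \<longleftrightarrow>
    graded_free_resolution n I s e D \<and>
    (\<forall>i. \<forall>j<length (s i). \<forall>l<length (s (Suc i)). D i $$ (j, l) \<in> irrelevant_ideal n)"

text \<open>
  The graded Betti number in homological degree \<open>r\<close> and internal degree \<open>d\<close> of \<open>R/I\<close>,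
  \<open>R = poly_ring n\<close>. Minimal graded free resolutions of \<open>R/I\<close> exist for homogeneous \<open>I\<close> and
  are unique up to isomorphism, so the description determines a number.
\<close>

definition graded_betti :: "nat \<Rightarrow> 'a::field mpoly set \<Rightarrow> int \<Rightarrow> int \<Rightarrow> nat" where
  "graded_betti n I r d =
    (if r < 0 \<or> d < 0 then 0
     else THE b. \<exists>s e D. minimal_graded_free_resolution n I s e D \<and> b = count_list (s (nat r)) d)"

end

theory Submission
  imports Defs "Jordan_Normal_Form.Determinant"
begin

text \<open>
  Write \<open>I\<^sub>k\<close> for the path ideal of \<open>L\<^sub>k\<close>, so that \<open>I\<^sub>n = I\<^bsub>n-1\<^esub> + (g)\<close> with
  \<open>g = x\<^sub>n g'\<close> and \<open>g' = x\<^bsub>n-p+1\<^esub> \<cdots> x\<^bsub>n-1\<^esub>\<close>. The colon ideal \<open>I\<^bsub>n-1\<^esub> : g\<close> is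
  \<open>K = I\<^bsub>n-p-1\<^esub> + (x\<^bsub>n-p\<^esub>)\<close>, hence \<open>R/I\<^sub>n\<close> is resolved by the mapping cone of a map
  of resolutions that lifts the multiplication \<open>R/K \<rightarrow> R/I\<^bsub>n-1\<^esub>\<close> by \<open>g\<close>. Already \<open>g'\<close> maps \<open>K\<close> into
  \<open>I\<^bsub>n-1\<^esub>\<close>, so one may take \<open>x\<^sub>n\<close> times a lift of the multiplication by \<open>g'\<close>; all its
  entries are then divisible by \<open>x\<^sub>n\<close>, and the cone is minimal. The same construction with
  \<open>g' = 1\<close> resolves \<open>K\<close>. Degrees of generators in these cones add up to the recursion, because
  graded Betti numbers do not depend on the minimal resolution: comparison maps in both
  directions compose to maps homotopic to the identity, and become mutually inverse after
  passing to constant coefficients.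
\<close>

section \<open>Polynomials and monomial ideals\<close>

abbreviation polys :: "nat \<Rightarrow> 'a::field mpoly set" where
  "polys n \<equiv> carrier (poly_ring n)"

lemma polys_iff: "f \<in> polys n \<longleftrightarrow> (\<forall>m\<in>Poly_Mapping.keys f. Poly_Mapping.keys m \<subseteq> {1..n})"
  by (simp add: poly_ring_def)

lemma keys_add_nat: "Poly_Mapping.keys (a + b :: 'b \<Rightarrow>\<^sub>0 nat) = Poly_Mapping.keys a \<union> Poly_Mapping.keys b"
  by (auto simp: in_keys_iff lookup_add)

lemma polys_0 [simp]: "0 \<in> polys n"
  by (simp add: polys_iff)

lemma polys_single: "Poly_Mapping.keys m \<subseteq> {1..n} \<Longrightarrow> Poly_Mapping.single m c \<in> polys n"
  by (simp add: polys_iff)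

lemma polys_1 [simp]: "1 \<in> polys n"
  by (simp add: polys_iff)

lemma polys_uminus [simp]: "- f \<in> polys n \<longleftrightarrow> f \<in> polys n"
  by (simp add: polys_iff in_keys_iff)

lemma polys_add [simp]: "f \<in> polys n \<Longrightarrow> g \<in> polys n \<Longrightarrow> f + g \<in> polys n"
  using Poly_Mapping.keys_add[of f g] by (fastforce simp: polys_iff)

lemma polys_diff [simp]: "f \<in> polys n \<Longrightarrow> g \<in> polys n \<Longrightarrow> f - g \<in> polys n"
  using polys_add[of f n "- g"] by simp

lemma polys_mult [simp]:
  assumes "f \<in> polys n" "g \<in> polys n"
  shows "f * g \<in> polys n"
  unfolding polys_iff
proof
  fix m assume "m \<in> Poly_Mapping.keys (f * g)"
  then obtain a b where "m = a + b" "a \<in> Poly_Mapping.keys f" "b \<in> Poly_Mapping.keys g"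
    using Poly_Mapping.keys_mult[of f g] by blast
  then show "Poly_Mapping.keys m \<subseteq> {1..n}"
    using assms by (fastforce simp: polys_iff keys_add_nat)
qed

lemma polys_sum: "(\<And>i. i \<in> A \<Longrightarrow> f i \<in> polys n) \<Longrightarrow> (\<Sum>i\<in>A. f i) \<in> polys n"
  by (induction A rule: infinite_finite_induct) auto

lemma cring_poly_ring: "cring (poly_ring n :: 'a::field mpoly ring)"
proof (intro cringI abelian_groupI comm_monoidI)
  fix f :: "'a mpoly"
  assume "f \<in> polys n"
  then show "\<exists>g\<in>polys n. g \<oplus>\<^bsub>poly_ring n\<^esub> f = \<zero>\<^bsub>poly_ring n\<^esub>"
    by (intro bexI[of _ "- f"]) (auto simp: poly_ring_def in_keys_iff)
next
  fix f g :: "'a mpoly" assume "f \<in> polys n" "g \<in> polys n"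
  then show "f \<oplus>\<^bsub>poly_ring n\<^esub> g \<in> polys n" "f \<otimes>\<^bsub>poly_ring n\<^esub> g \<in> polys n"
    using polys_add[of f n g] polys_mult[of f n g] by (simp_all add: poly_ring_def)
qed (use polys_0 polys_1 in \<open>auto simp: poly_ring_def algebra_simps\<close>)

lemma poly_mapping_sum_singles:
  fixes f :: "'b \<Rightarrow>\<^sub>0 'c::comm_monoid_add"
  shows "f = (\<Sum>k\<in>Poly_Mapping.keys f. Poly_Mapping.single k (Poly_Mapping.lookup f k))"
proof (rule poly_mapping_eqI)
  fix k
  have "(\<Sum>i\<in>Poly_Mapping.keys f. Poly_Mapping.lookup (Poly_Mapping.single i (Poly_Mapping.lookup f i)) k)
      = (\<Sum>i\<in>Poly_Mapping.keys f. if i = k then Poly_Mapping.lookup f k else 0)"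
    by (intro sum.cong) (auto simp: lookup_single)
  then show "Poly_Mapping.lookup f k
      = Poly_Mapping.lookup (\<Sum>k\<in>Poly_Mapping.keys f. Poly_Mapping.single k (Poly_Mapping.lookup f k)) k"
    by (simp add: lookup_sum in_keys_iff)
qed

lemma mon_degree_superset:
  "finite A \<Longrightarrow> Poly_Mapping.keys m \<subseteq> A \<Longrightarrow> mon_degree m = (\<Sum>i\<in>A. Poly_Mapping.lookup m i)"
  unfolding mon_degree_def by (intro sum.mono_neutral_left) (auto simp: in_keys_iff)

lemma mon_degree_add: "mon_degree (a + b) = mon_degree a + mon_degree b"
  by (simp add: mon_degree_superset[of "Poly_Mapping.keys a \<union> Poly_Mapping.keys b"] keys_add_nat lookup_add sum.distrib)

lemma homogeneous_0 [simp]: "homogeneous d 0"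
  by (simp add: homogeneous_def)

lemma homogeneous_1 [simp]: "homogeneous 0 1"
  by (simp add: homogeneous_def mon_degree_def)

lemma homogeneous_single: "homogeneous (int (mon_degree m)) (Poly_Mapping.single m c)"
  by (simp add: homogeneous_def)

lemma homogeneous_uminus [simp]: "homogeneous d (- f) \<longleftrightarrow> homogeneous d f"
  by (simp add: homogeneous_def in_keys_iff)

lemma homogeneous_add: "homogeneous d f \<Longrightarrow> homogeneous d g \<Longrightarrow> homogeneous d (f + g)"
  using Poly_Mapping.keys_add[of f g] by (fastforce simp: homogeneous_def)

lemma homogeneous_diff: "homogeneous d f \<Longrightarrow> homogeneous d g \<Longrightarrow> homogeneous d (f - g)"
  using homogeneous_add[of d f "- g"] by simp

lemma homogeneous_mult:
  assumes "homogeneous d f" "homogeneous e g" "d + e = c"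
  shows "homogeneous c (f * g)"
  unfolding homogeneous_def
proof
  fix m assume "m \<in> Poly_Mapping.keys (f * g)"
  then obtain a b where "m = a + b" "a \<in> Poly_Mapping.keys f" "b \<in> Poly_Mapping.keys g"
    using Poly_Mapping.keys_mult[of f g] by blast
  then show "int (mon_degree m) = c"
    using assms by (fastforce simp: homogeneous_def mon_degree_add)
qed

lemma homogeneous_sum: "(\<And>i. i \<in> A \<Longrightarrow> homogeneous d (f i)) \<Longrightarrow> homogeneous d (\<Sum>i\<in>A. f i)"
  by (induction A rule: infinite_finite_induct) (auto intro: homogeneous_add)

section \<open>Homogeneous components and graded ideals\<close>

text \<open>The degree \<open>d\<close> component. Integer \<open>d\<close> covers differences of
  basis degrees, which may be negative and then give 0.\<close>

definition hcomp :: "int \<Rightarrow> 'a::field mpoly \<Rightarrow> 'a mpoly" where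
  "hcomp d = Poly_Mapping.mapp (\<lambda>m c. if int (mon_degree m) = d then c else 0)"

lemma lookup_hcomp:
  "Poly_Mapping.lookup (hcomp d f) m = (if int (mon_degree m) = d then Poly_Mapping.lookup f m else 0)"
  by (simp add: hcomp_def Poly_Mapping.lookup_mapp in_keys_iff when_def)

lemma keys_hcomp: "Poly_Mapping.keys (hcomp d f) = {m\<in>Poly_Mapping.keys f. int (mon_degree m) = d}"
  by (auto simp: in_keys_iff lookup_hcomp split: if_splits)

lemma hcomp_homogeneous [simp]: "homogeneous d (hcomp d f)"
  by (simp add: homogeneous_def keys_hcomp)

lemma hcomp_polys [simp]: "f \<in> polys n \<Longrightarrow> hcomp d f \<in> polys n"
  by (simp add: polys_iff keys_hcomp)

lemma hcomp_id: "homogeneous d f \<Longrightarrow> hcomp d f = f"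
  by (intro poly_mapping_eqI) (auto simp: lookup_hcomp homogeneous_def in_keys_iff)

lemma hcomp_add: "hcomp d (f + g) = hcomp d f + hcomp d g"
  by (intro poly_mapping_eqI) (simp add: lookup_hcomp lookup_add)

lemma hcomp_diff: "hcomp d (f - g) = hcomp d f - hcomp d g"
  by (intro poly_mapping_eqI) (simp add: lookup_hcomp lookup_minus)

lemma hcomp_0 [simp]: "hcomp d 0 = 0"
  by (intro poly_mapping_eqI) (simp add: lookup_hcomp)

lemma hcomp_sum: "hcomp d (\<Sum>i\<in>A. f i) = (\<Sum>i\<in>A. hcomp d (f i))"
  by (induction A rule: infinite_finite_induct) (simp_all add: hcomp_add)

text \<open>Split \<open>f\<close> into its component of degree \<open>e\<close> and a rest
  \<open>r\<close>. A monomial of \<open>h * r\<close> has degree \<open>c\<close> plus a degree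
  other than \<open>e\<close>, so \<open>r\<close> contributes nothing in degree
  \<open>d\<close>.\<close>

lemma hcomp_mult:
  assumes h: "homogeneous c h" and d: "d = c + e"
  shows "hcomp d (h * f) = h * hcomp e f"
proof -
  define r where "r = f - hcomp e f"
  have r: "int (mon_degree m) \<noteq> e" if "m \<in> Poly_Mapping.keys r" for m
    using that by (auto simp: r_def in_keys_iff lookup_minus lookup_hcomp)
  have "hcomp d (h * r) = 0"
  proof (rule poly_mapping_eqI)
    fix m
    have "m \<notin> Poly_Mapping.keys (h * r)" if m: "int (mon_degree m) = d"
    proof
      assume "m \<in> Poly_Mapping.keys (h * r)"
      then obtain a b where "m = a + b" "a \<in> Poly_Mapping.keys h" "b \<in> Poly_Mapping.keys r"
        using Poly_Mapping.keys_mult[of h r] by blast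
      then show False using h r[of b] m d by (auto simp: mon_degree_add homogeneous_def)
    qed
    then show "Poly_Mapping.lookup (hcomp d (h * r)) m = Poly_Mapping.lookup 0 m"
      by (simp add: lookup_hcomp in_keys_iff)
  qed
  moreover have "hcomp d (h * hcomp e f) = h * hcomp e f"
    using homogeneous_mult[OF h hcomp_homogeneous] d by (intro hcomp_id) simp
  moreover have "h * f = h * hcomp e f + h * r"
    by (simp add: r_def algebra_simps)
  ultimately show ?thesis by (simp add: hcomp_add)
qed

text \<open>Gradedness is stated as closure under components, the form needed to replace arbitrary
  lifts modulo \<open>I\<close> by homogeneous ones.\<close>

locale graded_ideal = ideal I "poly_ring n" for I :: "'a::field mpoly set" and n +
  assumes hcomp_closed: "f \<in> I \<Longrightarrow> hcomp d f \<in> I"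
begin

lemma subset: "f \<in> I \<Longrightarrow> f \<in> polys n"
  by (rule Icarr)

lemma zero_mem [simp]: "0 \<in> I"
  using additive_subgroup.zero_closed[OF is_additive_subgroup] by (simp add: poly_ring_def)

lemma add_mem: "f \<in> I \<Longrightarrow> g \<in> I \<Longrightarrow> f + g \<in> I"
  using additive_subgroup.a_closed[OF is_additive_subgroup] by (simp add: poly_ring_def)

lemma mult_mem: "f \<in> polys n \<Longrightarrow> g \<in> I \<Longrightarrow> f * g \<in> I"
  using I_l_closed[of g f] by (simp add: poly_ring_def)

lemma uminus_mem: "f \<in> I \<Longrightarrow> - f \<in> I"
  using mult_mem[of "- 1" f] by simp

lemma diff_mem: "f \<in> I \<Longrightarrow> g \<in> I \<Longrightarrow> f - g \<in> I"
  using add_mem[of f "- g"] uminus_mem[of g] by simp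

lemma sum_mem: "(\<And>i. i \<in> A \<Longrightarrow> f i \<in> I) \<Longrightarrow> (\<Sum>i\<in>A. f i) \<in> I"
  by (induction A rule: infinite_finite_induct) (auto intro: add_mem)

lemma mem_cong: "f - g \<in> I \<Longrightarrow> f \<in> I \<longleftrightarrow> g \<in> I"
  using diff_mem[of f "f - g"] add_mem[of "f - g" g] by auto

end

section \<open>Monomial ideals\<close>

definition mdvd :: "(nat \<Rightarrow>\<^sub>0 nat) \<Rightarrow> (nat \<Rightarrow>\<^sub>0 nat) \<Rightarrow> bool" where
  "mdvd m k \<longleftrightarrow> (\<forall>j. Poly_Mapping.lookup m j \<le> Poly_Mapping.lookup k j)"

lemma mdvd_refl [simp]: "mdvd m m"
  by (simp add: mdvd_def)

lemma mdvd_add: "mdvd m k \<Longrightarrow> mdvd m (a + k)"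
  by (simp add: mdvd_def lookup_add trans_le_add2)

lemma mdvdE:
  assumes "mdvd m k"
  obtains c where "k = m + c"
proof
  show "k = m + (k - m)"
    using assms by (intro poly_mapping_eqI) (simp add: mdvd_def lookup_add lookup_minus)
qed

text \<open>The ideal generated by the monomials with exponents in \<open>M\<close>, given by its
  membership test. Sums and colons then become divisibility questions about exponents.\<close>

definition monomial_ideal :: "nat \<Rightarrow> (nat \<Rightarrow>\<^sub>0 nat) set \<Rightarrow> 'a::field mpoly set" where
  "monomial_ideal n M = {f \<in> polys n. \<forall>k\<in>Poly_Mapping.keys f. \<exists>m\<in>M. mdvd m k}"

lemma monomial_ideal_polys: "f \<in> monomial_ideal n M \<Longrightarrow> f \<in> polys n"
  and monomial_idealD: "f \<in> monomial_ideal n M \<Longrightarrow> k \<in> Poly_Mapping.keys f \<Longrightarrow> \<exists>m\<in>M. mdvd m k"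
  unfolding monomial_ideal_def by blast+

lemma monomial_ideal_mono: "f \<in> monomial_ideal n M \<Longrightarrow> M \<subseteq> N \<Longrightarrow> f \<in> monomial_ideal n N"
  unfolding monomial_ideal_def by blast

lemma single_mem_monomial_ideal:
  "m \<in> M \<Longrightarrow> Poly_Mapping.keys m \<subseteq> {1..n} \<Longrightarrow> Poly_Mapping.single m c \<in> monomial_ideal n M"
  by (auto simp: monomial_ideal_def polys_single intro!: bexI[of _ m])

lemma graded_ideal_monomial_ideal: "graded_ideal (monomial_ideal n M :: 'a::field mpoly set) n"
proof -
  interpret cring "poly_ring n :: 'a mpoly ring" by (rule cring_poly_ring)
  let ?I = "monomial_ideal n M :: 'a mpoly set"
  have inv: "\<ominus>\<^bsub>poly_ring n\<^esub> f = - f" if "f \<in> polys n" for f :: "'a mpoly"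
    using that by (intro minus_equality) (auto simp: poly_ring_def in_keys_iff)
  have add: "f + g \<in> ?I" if "f \<in> ?I" "g \<in> ?I" for f g
    using that Poly_Mapping.keys_add[of f g] by (fastforce simp: monomial_ideal_def)
  have mult: "f * g \<in> ?I" if "f \<in> polys n" and g: "g \<in> ?I" for f g
    unfolding monomial_ideal_def
  proof (intro CollectI conjI ballI)
    show "f * g \<in> polys n" using that by (simp add: monomial_ideal_def)
    fix k assume "k \<in> Poly_Mapping.keys (f * g)"
    then obtain a b where k: "k = a + b" and b: "b \<in> Poly_Mapping.keys g"
      using Poly_Mapping.keys_mult[of f g] by blast
    show "\<exists>m\<in>M. mdvd m k" using monomial_idealD[OF g b] mdvd_add k by blast
  qed
  have neg: "- f \<in> ?I" if "f \<in> ?I" for f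
    using that by (auto simp: monomial_ideal_def in_keys_iff)
  have sub: "f \<in> polys n" if "f \<in> ?I" for f
    using that by (simp add: monomial_ideal_def)
  have "subgroup ?I (add_monoid (poly_ring n))"
  proof (rule add.subgroupI)
    show "?I \<noteq> {}" using polys_0 by (auto simp: monomial_ideal_def intro!: exI[of _ 0])
  qed (use sub neg inv add in \<open>auto simp: a_inv_def[symmetric] poly_ring_def\<close>)
  then have "ideal ?I (poly_ring n)"
  proof (rule idealI[OF ring_axioms])
    fix f g :: "'a mpoly" assume "f \<in> ?I" "g \<in> polys n"
    then have "g * f \<in> ?I" by (intro mult)
    then show "g \<otimes>\<^bsub>poly_ring n\<^esub> f \<in> ?I" "f \<otimes>\<^bsub>poly_ring n\<^esub> g \<in> ?I"
      by (simp_all add: poly_ring_def mult.commute)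
  qed
  then show ?thesis
    by (intro graded_ideal.intro graded_ideal_axioms.intro) (auto simp: monomial_ideal_def keys_hcomp)
qed

text \<open>A polynomial is the sum of its terms, and each term of a member is a multiple of some
  generator; the cofactor stays in the ring because its variables occur in the term.\<close>

lemma Idl_monomials:
  assumes M: "\<And>m. m \<in> M \<Longrightarrow> Poly_Mapping.keys m \<subseteq> {1..n}"
  shows "Idl\<^bsub>poly_ring n\<^esub> ((\<lambda>m. Poly_Mapping.single m 1) ` M) = (monomial_ideal n M :: 'a::field mpoly set)"
    (is "Idl\<^bsub>_\<^esub> ?S = _")
proof
  interpret cring "poly_ring n :: 'a mpoly ring" by (rule cring_poly_ring)
  have S: "?S \<subseteq> polys n" using M by (intro image_subsetI polys_single)
  interpret I: ideal "Idl\<^bsub>poly_ring n\<^esub> ?S" "poly_ring n" by (rule genideal_ideal[OF S])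
  interpret J: graded_ideal "monomial_ideal n M :: 'a mpoly set" n by (rule graded_ideal_monomial_ideal)
  show "Idl\<^bsub>poly_ring n\<^esub> ?S \<subseteq> monomial_ideal n M"
    by (intro genideal_minimal J.is_ideal image_subsetI single_mem_monomial_ideal M)
  show "monomial_ideal n M \<subseteq> Idl\<^bsub>poly_ring n\<^esub> ?S"
  proof
    fix f :: "'a mpoly" assume f: "f \<in> monomial_ideal n M"
    have single: "Poly_Mapping.single k (Poly_Mapping.lookup f k) \<in> Idl\<^bsub>poly_ring n\<^esub> ?S" if k: "k \<in> Poly_Mapping.keys f" for k
    proof -
      obtain m c where mc: "m \<in> M" "k = m + c" using monomial_idealD[OF f k] mdvdE by metis
      have "Poly_Mapping.keys k \<subseteq> {1..n}" using monomial_ideal_polys[OF f] k polys_iff by blast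
      then have "Poly_Mapping.keys c \<subseteq> {1..n}" using mc by (simp add: keys_add_nat)
      then have "Poly_Mapping.single c (Poly_Mapping.lookup f k) * Poly_Mapping.single m 1 \<in> Idl\<^bsub>poly_ring n\<^esub> ?S"
        using I.I_l_closed[of "Poly_Mapping.single m 1" "Poly_Mapping.single c (Poly_Mapping.lookup f k)"]
          subsetD[OF genideal_self[OF S] imageI[OF mc(1)]] polys_single[of c n]
        by (simp add: poly_ring_def)
      then show ?thesis using mc by (simp add: mult_single add.commute)
    qed
    have sum: "(\<Sum>i\<in>A. g i) \<in> Idl\<^bsub>poly_ring n\<^esub> ?S" if "\<And>i. i \<in> A \<Longrightarrow> g i \<in> Idl\<^bsub>poly_ring n\<^esub> ?S"
      for A :: "(nat \<Rightarrow>\<^sub>0 nat) set" and g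
      using that I.zero_closed I.a_closed
      by (induction A rule: infinite_finite_induct) (auto simp: poly_ring_def)
    show "f \<in> Idl\<^bsub>poly_ring n\<^esub> ?S"
      by (subst poly_mapping_sum_singles[of f]) (rule sum[OF single])
  qed
qed

lemma irrelevant_ideal_monomial:
  "irrelevant_ideal n = monomial_ideal n ((\<lambda>i. Poly_Mapping.single i 1) ` {1..n})"
  by (subst Idl_monomials[symmetric]) (auto simp: irrelevant_ideal_def image_image var_def)

text \<open>No variable divides the monomial 1. Minimality enters the uniqueness proof only in this
  form.\<close>

lemma irrelevant_const: "f \<in> irrelevant_ideal n \<Longrightarrow> Poly_Mapping.lookup f 0 = 0"
proof (rule ccontr)
  assume "f \<in> irrelevant_ideal n" "Poly_Mapping.lookup f 0 \<noteq> 0"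
  then have "0 \<in> Poly_Mapping.keys f" "f \<in> irrelevant_ideal n" by (simp_all add: in_keys_iff)
  then obtain i where "mdvd (Poly_Mapping.single i 1) 0"
    unfolding irrelevant_ideal_monomial using monomial_idealD by blast
  then have "Poly_Mapping.lookup (Poly_Mapping.single i (1::nat)) i \<le> Poly_Mapping.lookup 0 i"
    unfolding mdvd_def by blast
  then show False by simp
qed

lemma var_irrelevant: "i \<in> {1..n} \<Longrightarrow> var i \<in> irrelevant_ideal n"
  unfolding irrelevant_ideal_monomial var_def by (intro single_mem_monomial_ideal) auto

lemma graded_ideal_irrelevant: "graded_ideal (irrelevant_ideal n) n"
  unfolding irrelevant_ideal_monomial by (rule graded_ideal_monomial_ideal)

text \<open>Exponent vectors satisfy \<open>a + b = 0\<close> only for \<open>a = b = 0\<close>, so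
  a factor without constant term gives a product without one. Splitting off the constant terms of
  both factors reduces to this case.\<close>

lemma lookup_mult_0:
  fixes f g :: "'a::field mpoly"
  shows "Poly_Mapping.lookup (f * g) 0 = Poly_Mapping.lookup f 0 * Poly_Mapping.lookup g 0"
proof -
  have *: "Poly_Mapping.lookup (f * g) 0 = 0" if "Poly_Mapping.lookup f 0 = 0" for f g :: "'a mpoly"
  proof (rule ccontr)
    assume "Poly_Mapping.lookup (f * g) 0 \<noteq> 0"
    then obtain a b where ab: "0 = a + b" "a \<in> Poly_Mapping.keys f"
      using Poly_Mapping.keys_mult[of f g] by (fastforce simp: in_keys_iff)
    have "Poly_Mapping.keys a = {}" using keys_add_nat[of a b] ab by simp
    then have "a = 0" by simp
    then show False using ab that by (simp add: in_keys_iff)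
  qed
  define c where "c = (\<lambda>f :: 'a mpoly. Poly_Mapping.single 0 (Poly_Mapping.lookup f 0) :: 'a mpoly)"
  have c: "Poly_Mapping.lookup (f - c f) 0 = 0" for f by (simp add: c_def lookup_minus)
  have "f * g = c f * c g + ((f - c f) * g + (g - c g) * c f)" by (simp add: algebra_simps)
  then have "Poly_Mapping.lookup (f * g) 0 = Poly_Mapping.lookup (c f * c g) 0"
    by (simp only: lookup_add *[OF c]) simp
  then show ?thesis by (simp add: c_def mult_single)
qed

section \<open>Lifting along graded free resolutions\<close>

lemma free_module_iff:
  "v \<in> free_module n m \<longleftrightarrow> v \<in> carrier_vec m \<and> (\<forall>j<m. v $ j \<in> polys n)"
  by (simp add: free_module_def)

lemma free_module_diff: "u \<in> free_module n m \<Longrightarrow> w \<in> free_module n m \<Longrightarrow> u - w \<in> free_module n m"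
  by (auto simp: free_module_iff)

lemma mult_mat_unit_vec:
  fixes A :: "'a::semiring_1 mat"
  assumes "A \<in> carrier_mat a b" "l < b"
  shows "A *\<^sub>v unit_vec b l = col A l"
  using assms by (intro eq_vecI) auto

text \<open>Elements of degree \<open>d\<close> in the direct sum of the twisted modules
  \<open>R(- s ! j)\<close>.\<close>

definition graded_vec :: "nat \<Rightarrow> int list \<Rightarrow> int \<Rightarrow> 'a::field mpoly vec \<Rightarrow> bool" where
  "graded_vec n s d v \<longleftrightarrow> v \<in> free_module n (length s) \<and> (\<forall>j<length s. homogeneous (d - s ! j) (v $ j))"

text \<open>Degree 0 maps into the free module with basis degrees \<open>s\<close> from the one with
  basis degrees \<open>t\<close>.\<close>

definition graded_mat :: "nat \<Rightarrow> int list \<Rightarrow> int list \<Rightarrow> 'a::field mpoly mat \<Rightarrow> bool" where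
  "graded_mat n s t A \<longleftrightarrow> A \<in> carrier_mat (length s) (length t) \<and>
    (\<forall>j<length s. \<forall>l<length t. A $$ (j, l) \<in> polys n \<and> homogeneous (t ! l - s ! j) (A $$ (j, l)))"

lemma graded_mat_carrier: "graded_mat n s t A \<Longrightarrow> A \<in> carrier_mat (length s) (length t)"
  by (simp add: graded_mat_def)

lemma graded_mat_col: "graded_mat n s t A \<Longrightarrow> l < length t \<Longrightarrow> graded_vec n s (t ! l) (col A l)"
  by (auto simp: graded_mat_def graded_vec_def free_module_iff)

lemma graded_mat_zero: "graded_mat n s t (0\<^sub>m (length s) (length t))"
  by (simp add: graded_mat_def)

lemma graded_mat_one: "graded_mat n s s (1\<^sub>m (length s))"
  by (simp add: graded_mat_def)

lemma graded_mat_minus: "graded_mat n s t A \<Longrightarrow> graded_mat n s t B \<Longrightarrow> graded_mat n s t (A - B)"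
  by (auto simp: graded_mat_def intro!: homogeneous_diff)

lemma graded_mat_uminus: "graded_mat n s t A \<Longrightarrow> graded_mat n s t (- A)"
  by (auto simp: graded_mat_def)

lemma graded_mat_mult:
  assumes "graded_mat n s t A" "graded_mat n t u B"
  shows "graded_mat n s u (A * B)"
proof -
  have "(A * B) $$ (j, l) = (\<Sum>k<length t. A $$ (j, k) * B $$ (k, l))"
    if "j < length s" "l < length u" for j l
    using assms that by (auto simp: graded_mat_def scalar_prod_def atLeast0LessThan intro!: sum.cong)
  then show ?thesis
    using assms unfolding graded_mat_def
    by (auto intro!: polys_sum homogeneous_sum homogeneous_mult)
qed

lemma graded_mat_shift:
  "graded_mat n s t A \<Longrightarrow> graded_mat n (map ((+) a) s) (map ((+) a) t) A"
  by (simp add: graded_mat_def)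

lemma mult_free_module:
  assumes "graded_mat n s t A" "w \<in> free_module n (length t)"
  shows "A *\<^sub>v w \<in> free_module n (length s)"
  using assms by (auto simp: graded_mat_def free_module_iff scalar_prod_def intro!: polys_sum)

text \<open>A map out of a free module may be prescribed on the basis, so lifting a matrix through
  \<open>D\<close> reduces to lifting its columns; \<open>B\<close> has the chosen preimages as
  columns.\<close>

lemma mat_of_columns:
  assumes "graded_mat n s u A" "graded_mat n s t D"
    and "\<And>l. l < length u \<Longrightarrow> \<exists>w. graded_vec n t (u ! l) w \<and> D *\<^sub>v w = col A l"
  shows "\<exists>B. graded_mat n t u B \<and> D * B = A"
proof -
  from assms(3) obtain w where
    w: "\<And>l. l < length u \<Longrightarrow> graded_vec n t (u ! l) (w l) \<and> D *\<^sub>v w l = col A l" by metis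
  define B where "B = mat (length t) (length u) (\<lambda>(j, l). w l $ j)"
  have col: "col B l = w l" if "l < length u" for l
    using w[OF that] that by (intro eq_vecI) (auto simp: B_def graded_vec_def free_module_iff)
  have "graded_mat n t u B"
    using w by (auto simp: B_def graded_mat_def graded_vec_def free_module_iff)
  moreover have "D * B = A"
  proof (rule mat_col_eqI)
    fix l assume "l < dim_col A"
    then have l: "l < length u" using graded_mat_carrier[OF assms(1)] by simp
    have "col (D * B) l = D *\<^sub>v col B l"
      by (rule col_mult2[OF graded_mat_carrier[OF assms(2)] _ l]) (simp add: B_def)
    then show "col (D * B) l = col A l" using w l col by simp
  qed (use graded_mat_carrier[OF assms(1)] graded_mat_carrier[OF assms(2)] in \<open>auto simp: B_def\<close>)
  ultimately show ?thesis by blast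
qed

text \<open>Since \<open>r $ j\<close> has degree \<open>s ! j - c\<close>, exactly the component of
  \<open>v $ j\<close> in degree \<open>d - s ! j\<close> lands in degree
  \<open>d - c\<close>.\<close>

lemma scalar_prod_hcomp:
  assumes "r \<in> carrier_vec (length s)" "v \<in> carrier_vec (length s)"
    and "\<And>j. j < length s \<Longrightarrow> homogeneous (s ! j - c) (r $ j)"
  shows "r \<bullet> vec (length s) (\<lambda>j. hcomp (d - s ! j) (v $ j)) = hcomp (d - c) (r \<bullet> v)"
proof -
  have "r $ j * hcomp (d - s ! j) (v $ j) = hcomp (d - c) (r $ j * v $ j)" if "j < length s" for j
    by (rule hcomp_mult[OF assms(3)[OF that], symmetric]) simp
  then show ?thesis
    using assms(1,2) by (simp add: scalar_prod_def hcomp_sum)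
qed

text \<open>
  Lifting of vectors, starting with the kernel of the augmentation, becomes uniform in \<open>i\<close>.
\<close>

definition cycle :: "'a::field mpoly set \<Rightarrow> 'a mpoly vec \<Rightarrow> (nat \<Rightarrow> 'a mpoly mat) \<Rightarrow> nat \<Rightarrow> 'a mpoly vec \<Rightarrow> bool"
  where "cycle I e D i v \<longleftrightarrow>
    (case i of 0 \<Rightarrow> e \<bullet> v \<in> I | Suc k \<Rightarrow> D k *\<^sub>v v = 0\<^sub>v (dim_row (D k)))"

text \<open>Puts exactness at the augmentation and exactness at the differentials into one clause,
  so that later inductions need no separate treatment of \<open>F\<close> in degree 0.\<close>

lemma graded_free_resolution_iff:
  "graded_free_resolution n I s e D \<longleftrightarrow>
    e \<in> free_module n (length (s 0)) \<and>
    (\<forall>j<length (s 0). homogeneous (s 0 ! j) (e $ j)) \<and>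
    (\<forall>i. graded_mat n (s i) (s (Suc i)) (D i)) \<and>
    (\<forall>f\<in>polys n. \<exists>v\<in>free_module n (length (s 0)). f - e \<bullet> v \<in> I) \<and>
    (\<forall>i. \<forall>v\<in>free_module n (length (s i)).
      cycle I e D i v \<longleftrightarrow> (\<exists>w\<in>free_module n (length (s (Suc i))). v = D i *\<^sub>v w))"
    (is "?L \<longleftrightarrow> ?e \<and> ?h \<and> ?m \<and> ?a \<and> ?x")
proof (cases ?m)
  case False
  then show ?thesis by (auto simp: graded_free_resolution_def graded_mat_def)
next
  case True
  then have dim: "dim_row (D i) = length (s i)" for i by (auto simp: graded_mat_def)
  have 0: "{v \<in> free_module n (length (s i)). cycle I e D i v} =
      (\<lambda>w. D i *\<^sub>v w) ` free_module n (length (s (Suc i))) \<longleftrightarrow>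
      (\<forall>v\<in>free_module n (length (s i)).
        cycle I e D i v \<longleftrightarrow> (\<exists>w\<in>free_module n (length (s (Suc i))). v = D i *\<^sub>v w))" for i
    using mult_free_module True by blast
  \<comment> \<open>Splitting off \<open>i = 0\<close> recovers the two exactness clauses of the
    definition.\<close>
  have all: "(\<forall>i. Q i) \<longleftrightarrow> Q 0 \<and> (\<forall>i. Q (Suc i))" for Q by (metis not0_implies_Suc)
  have "?L \<longleftrightarrow> ?e \<and> ?h \<and> ?m \<and> ?a \<and> (\<forall>i. {v \<in> free_module n (length (s i)). cycle I e D i v} =
      (\<lambda>w. D i *\<^sub>v w) ` free_module n (length (s (Suc i))))"
    unfolding graded_free_resolution_def graded_mat_def[symmetric]
    by (subst (2) all) (simp add: cycle_def dim)
  then show ?thesis by (simp only: 0)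
qed

section \<open>Homogeneous lifts and comparison maps\<close>

locale resolution = graded_ideal I n for I :: "'a::field mpoly set" and n +
  fixes s :: "nat \<Rightarrow> int list" and e :: "'a mpoly vec" and D :: "nat \<Rightarrow> 'a mpoly mat"
  assumes resolution: "graded_free_resolution n I s e D"
begin

lemma e_mem: "e \<in> free_module n (length (s 0))"
  and e_homogeneous: "j < length (s 0) \<Longrightarrow> homogeneous (s 0 ! j) (e $ j)"
  and D_graded: "graded_mat n (s i) (s (Suc i)) (D i)"
  and surjective: "f \<in> polys n \<Longrightarrow> \<exists>v\<in>free_module n (length (s 0)). f - e \<bullet> v \<in> I"
  and exact: "v \<in> free_module n (length (s i)) \<Longrightarrow>
    cycle I e D i v \<longleftrightarrow> (\<exists>w\<in>free_module n (length (s (Suc i))). v = D i *\<^sub>v w)"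
  using resolution unfolding graded_free_resolution_iff by blast+

lemma e_carrier [simp]: "e \<in> carrier_vec (length (s 0))"
  using e_mem by (simp add: free_module_iff)

lemma D_carrier [simp]: "D i \<in> carrier_mat (length (s i)) (length (s (Suc i)))"
  using D_graded by (rule graded_mat_carrier)

lemma dim_row_D [simp]: "dim_row (D i) = length (s i)"
  and dim_col_D [simp]: "dim_col (D i) = length (s (Suc i))"
  by (rule carrier_matD[OF D_carrier])+

text \<open>Exactness yields a preimage \<open>w\<close> that need not be homogeneous. Cutting each
  coordinate down to the required degree does not change its image, because \<open>v\<close> is
  homogeneous.\<close>

lemma lift_vec:
  assumes v: "graded_vec n (s i) d v" and "cycle I e D i v"
  shows "\<exists>w. graded_vec n (s (Suc i)) d w \<and> D i *\<^sub>v w = v"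
proof -
  from assms exact obtain w where w: "w \<in> free_module n (length (s (Suc i)))" "v = D i *\<^sub>v w"
    by (auto simp: graded_vec_def)
  let ?w = "vec (length (s (Suc i))) (\<lambda>j. hcomp (d - s (Suc i) ! j) (w $ j))"
  have "(D i *\<^sub>v ?w) $ j = v $ j" if j: "j < length (s i)" for j
  proof -
    have "row (D i) j \<bullet> ?w = hcomp (d - s i ! j) (row (D i) j \<bullet> w)"
      using w D_graded[of i] j
      by (intro scalar_prod_hcomp) (auto simp: free_module_iff graded_mat_def)
    also have "row (D i) j \<bullet> w = v $ j" using w j by simp
    also have "hcomp (d - s i ! j) (v $ j) = v $ j"
      using v j by (intro hcomp_id) (auto simp: graded_vec_def)
    finally show ?thesis using j by simp
  qed
  then have "D i *\<^sub>v ?w = v"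
    using v by (intro eq_vecI) (auto simp: graded_vec_def free_module_iff)
  moreover have "graded_vec n (s (Suc i)) d ?w"
    using w by (auto simp: graded_vec_def free_module_iff)
  ultimately show ?thesis by blast
qed

lemma lift_mat:
  assumes "graded_mat n (s i) u A" "\<And>l. l < length u \<Longrightarrow> cycle I e D i (col A l)"
  shows "\<exists>B. graded_mat n (s (Suc i)) u B \<and> D i * B = A"
  using assms by (intro mat_of_columns[OF _ D_graded]) (auto intro: lift_vec dest: graded_mat_col)

text \<open>The same truncation for the surjection onto \<open>R/I\<close>; the error term stays in
  \<open>I\<close> because \<open>I\<close> is closed under components.\<close>

lemma augmentation_lift:
  assumes "f \<in> polys n" "homogeneous d f"
  shows "\<exists>v. graded_vec n (s 0) d v \<and> e \<bullet> v - f \<in> I"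
proof -
  from surjective assms obtain v where v: "v \<in> free_module n (length (s 0))" "f - e \<bullet> v \<in> I" by blast
  let ?v = "vec (length (s 0)) (\<lambda>j. hcomp (d - s 0 ! j) (v $ j))"
  \<comment> \<open>The row \<open>e\<close> maps to \<open>R\<close> with its generator in degree
    0, hence \<open>c = 0\<close> in \<open>scalar_prod_hcomp\<close>.\<close>
  have "e \<bullet> ?v = hcomp (d - 0) (e \<bullet> v)"
    using v e_homogeneous by (intro scalar_prod_hcomp) (auto simp: free_module_iff)
  then have "f - e \<bullet> ?v = hcomp d (f - e \<bullet> v)"
    using assms by (simp add: hcomp_diff hcomp_id)
  then have "e \<bullet> ?v - f \<in> I"
    using uminus_mem[OF hcomp_closed[OF v(2), of d]] minus_diff_eq[of f "e \<bullet> ?v"] by (simp only:)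
  moreover have "graded_vec n (s 0) d ?v"
    using v by (auto simp: graded_vec_def free_module_iff)
  ultimately show ?thesis by blast
qed

lemma cycle_D: "w \<in> free_module n (length (s (Suc i))) \<Longrightarrow> cycle I e D i (D i *\<^sub>v w)"
  using exact[of "D i *\<^sub>v w" i] mult_free_module[OF D_graded] by blast

lemma cycle_Suc_col:
  assumes "D i * X = 0\<^sub>m (length (s i)) m" "X \<in> carrier_mat (length (s (Suc i))) m" "l < m"
  shows "cycle I e D (Suc i) (col X l)"
proof -
  have "D i *\<^sub>v col X l = col (D i * X) l"
    by (rule col_mult2[symmetric, OF D_carrier assms(2,3)])
  also have "\<dots> = 0\<^sub>v (length (s i))" using assms by simp
  finally show ?thesis by (simp add: cycle_def)
qed

text \<open>Each column of \<open>D (Suc i)\<close> is the image of a unit vector, hence a boundary,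
  hence a cycle.\<close>

lemma DD: "D i * D (Suc i) = 0\<^sub>m (length (s i)) (length (s (Suc (Suc i))))"
proof (rule mat_col_eqI)
  fix l assume "l < dim_col (0\<^sub>m (length (s i)) (length (s (Suc (Suc i)))) :: 'a mpoly mat)"
  then have l: "l < length (s (Suc (Suc i)))" by simp
  have "unit_vec (length (s (Suc (Suc i)))) l \<in> free_module n (length (s (Suc (Suc i))))"
    by (simp add: free_module_iff unit_vec_def)
  from cycle_D[OF this] have "cycle I e D (Suc i) (col (D (Suc i)) l)"
    using mult_mat_unit_vec[OF D_carrier l] by simp
  then have "D i *\<^sub>v col (D (Suc i)) l = 0\<^sub>v (length (s i))"
    by (simp add: cycle_def)
  then show "col (D i * D (Suc i)) l = col (0\<^sub>m (length (s i)) (length (s (Suc (Suc i))))) l"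
    using l col_mult2[OF D_carrier D_carrier l] by simp
qed auto

text \<open>The comparison theorem: only \<open>D\<close> has to be exact, while \<open>E\<close>
  may be any complex of graded free modules. Each \<open>\<phi> i * E i\<close> consists of cycles
  and therefore lifts through \<open>D i\<close>.\<close>

lemma comparison:
  assumes E: "\<And>i. graded_mat n (t i) (t (Suc i)) (E i)"
    and EE: "\<And>i. E i * E (Suc i) = 0\<^sub>m (length (t i)) (length (t (Suc (Suc i))))"
    and \<phi>0: "graded_mat n (s 0) (t 0) \<phi>0"
    and cycle: "\<And>l. l < length (t (Suc 0)) \<Longrightarrow> cycle I e D 0 (col (\<phi>0 * E 0) l)"
  obtains \<phi> where "\<phi> 0 = \<phi>0" "\<And>i. graded_mat n (s i) (t i) (\<phi> i)" "\<And>i. D i * \<phi> (Suc i) = \<phi> i * E i"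
proof -
  \<comment> \<open>The invariant carries the cycle condition that makes the next lift possible. Its
    clause for \<open>i = 0\<close> pins the start to \<open>\<phi>0\<close>, as dependent choice
    alone gives only some initial value.\<close>
  let ?P = "\<lambda>i \<phi>. graded_mat n (s i) (t i) \<phi> \<and> (i = 0 \<longrightarrow> \<phi> = \<phi>0) \<and>
    (\<forall>l<length (t (Suc i)). cycle I e D i (col (\<phi> * E i) l))"
  have "\<exists>\<phi>. \<forall>i. ?P i (\<phi> i) \<and> D i * \<phi> (Suc i) = \<phi> i * E i"
  proof (intro dependent_nat_choice)
    show "\<exists>\<phi>. ?P 0 \<phi>" using \<phi>0 cycle by blast
  next
    fix \<phi> i assume \<phi>: "?P i \<phi>"
    then obtain \<psi> where \<psi>: "graded_mat n (s (Suc i)) (t (Suc i)) \<psi>" "D i * \<psi> = \<phi> * E i"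
      using lift_mat[of i "t (Suc i)" "\<phi> * E i"] graded_mat_mult[OF _ E] by blast
    have c: "\<psi> \<in> carrier_mat (length (s (Suc i))) (length (t (Suc i)))"
        "\<phi> \<in> carrier_mat (length (s i)) (length (t i))"
        "E j \<in> carrier_mat (length (t j)) (length (t (Suc j)))" for j
      using \<psi> \<phi> E graded_mat_carrier by blast+
    \<comment> \<open>The new map inherits the invariant:
      \<open>D i * \<psi> = \<phi> * E i\<close>, and two consecutive \<open>E\<close> compose to
      0.\<close>
    have "D i * (\<psi> * E (Suc i)) = D i * \<psi> * E (Suc i)"
      using c by (intro assoc_mult_mat[symmetric]) auto
    also have "\<dots> = \<phi> * (E i * E (Suc i))"
      unfolding \<psi>(2) using c by (intro assoc_mult_mat) auto
    also have "\<dots> = 0\<^sub>m (length (s i)) (length (t (Suc (Suc i))))"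
      unfolding EE using c by simp
    finally have "cycle I e D (Suc i) (col (\<psi> * E (Suc i)) l)" if "l < length (t (Suc (Suc i)))" for l
      using c that by (intro cycle_Suc_col) auto
    then show "\<exists>\<psi>. ?P (Suc i) \<psi> \<and> D i * \<psi> = \<phi> * E i" using \<psi> by auto
  qed
  then show ?thesis using that by blast
qed

end

section \<open>Constant coefficients and uniqueness of graded Betti numbers\<close>

text \<open>On matrices over \<open>poly_ring n\<close> this is reduction modulo the irrelevant
  ideal, that is, tensoring with the base field.\<close>

abbreviation const_mat :: "'a::field mpoly mat \<Rightarrow> 'a mat" where
  "const_mat \<equiv> map_mat (\<lambda>f. Poly_Mapping.lookup f 0)"

interpretation const: semiring_hom "\<lambda>f :: 'a::field mpoly. Poly_Mapping.lookup f 0"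
  by unfold_locales (simp_all add: lookup_add lookup_mult_0)

text \<open>A homogeneous entry with nonzero constant term has degree 0. Reduced matrices thus
  connect only basis elements of equal degree, which allows counting degree by degree.\<close>

lemma graded_mat_const:
  assumes "graded_mat n s t A" "j < length s" "l < length t" "const_mat A $$ (j, l) \<noteq> 0"
  shows "s ! j = t ! l"
proof -
  have "0 \<in> Poly_Mapping.keys (A $$ (j, l))"
    using assms graded_mat_carrier[OF assms(1)] by (simp add: in_keys_iff)
  moreover have "homogeneous (t ! l - s ! j) (A $$ (j, l))"
    using assms by (simp add: graded_mat_def)
  ultimately have "int (mon_degree 0) = t ! l - s ! j" unfolding homogeneous_def by blast
  then show ?thesis by (simp add: mon_degree_def)
qed

lemma minimal_const:
  assumes "minimal_graded_free_resolution n I s e D"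
  shows "const_mat (D i) = 0\<^sub>m (length (s i)) (length (s (Suc i)))"
proof -
  have "D i \<in> carrier_mat (length (s i)) (length (s (Suc i)))"
    "\<And>j l. j < length (s i) \<Longrightarrow> l < length (s (Suc i)) \<Longrightarrow> D i $$ (j, l) \<in> irrelevant_ideal n"
    using assms by (simp_all add: minimal_graded_free_resolution_def graded_free_resolution_def)
  then show ?thesis using irrelevant_const[of "D i $$ _" n] by (intro eq_matI) auto
qed

lemma mult_left_const_0:
  assumes "A \<in> carrier_mat a b" "B \<in> carrier_mat b c" "const_mat A = 0\<^sub>m a b"
  shows "const_mat (A * B) = 0\<^sub>m a c"
  using const.mat_hom_mult[OF assms(1,2)] assms by simp

lemma mult_right_const_0:
  assumes "A \<in> carrier_mat a b" "B \<in> carrier_mat b c" "const_mat B = 0\<^sub>m b c"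
  shows "const_mat (A * B) = 0\<^sub>m a c"
  using const.mat_hom_mult[OF assms(1,2)] assms by simp

text \<open>
  In the induction, \<open>h\<close> is the homotopy in degree \<open>i\<close> and \<open>N\<close> the composite of the previous
  homotopy with the differential; only \<open>N * D i = 0\<close> matters for the next step.
\<close>

lemma (in resolution) nullhomotopic_const:
  assumes min: "\<And>i. const_mat (D i) = 0\<^sub>m (length (s i)) (length (s (Suc i)))"
    and \<alpha>: "\<And>i. graded_mat n (s i) (s i) (\<alpha> i)" "\<And>i. D i * \<alpha> (Suc i) = \<alpha> i * D i"
    and cycle: "\<And>l. l < length (s 0) \<Longrightarrow> cycle I e D 0 (col (\<alpha> 0) l)"
  shows "const_mat (\<alpha> i) = 0\<^sub>m (length (s i)) (length (s i))"
proof -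
  have "\<exists>h N. graded_mat n (s (Suc i)) (s i) h \<and> N \<in> carrier_mat (length (s i)) (length (s i)) \<and>
      \<alpha> i = D i * h + N \<and> N * D i = 0\<^sub>m (length (s i)) (length (s (Suc i))) \<and>
      const_mat N = 0\<^sub>m (length (s i)) (length (s i))"
  proof (induction i)
    case 0
    from lift_mat[OF \<alpha>(1) cycle] obtain h where "graded_mat n (s (Suc 0)) (s 0) h" "D 0 * h = \<alpha> 0"
      by blast
    moreover have "\<alpha> 0 \<in> carrier_mat (length (s 0)) (length (s 0))" using \<alpha>(1) graded_mat_carrier by blast
    moreover have "const_mat (0\<^sub>m (length (s 0)) (length (s 0))) = 0\<^sub>m (length (s 0)) (length (s 0))"
      by (intro eq_matI) auto
    \<comment> \<open>There is no homotopy below degree 0, so \<open>N\<close> starts as the zero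
      matrix.\<close>
    ultimately show ?case
      by (intro exI[of _ h] exI[of _ "0\<^sub>m (length (s 0)) (length (s 0))"]) auto
  next
    case (Suc i)
    then obtain h N where h: "graded_mat n (s (Suc i)) (s i) h"
      and N: "N \<in> carrier_mat (length (s i)) (length (s i))" and eq: "\<alpha> i = D i * h + N"
      and ND: "N * D i = 0\<^sub>m (length (s i)) (length (s (Suc i)))" by blast
    have c: "h \<in> carrier_mat (length (s (Suc i))) (length (s i))"
        "\<alpha> j \<in> carrier_mat (length (s j)) (length (s j))" for j
      using h \<alpha>(1) graded_mat_carrier by blast+
    \<comment> \<open>Subtracting \<open>h * D i\<close> leaves cycles:
      \<open>D i * \<alpha> (Suc i) = \<alpha> i * D i\<close> equals
      \<open>D i * h * D i + N * D i\<close>, and the last term is 0. The lift \<open>k\<close> of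
      \<open>X\<close> is the next homotopy, and \<open>h * D i\<close> is the next
      \<open>N\<close>.\<close>
    define X where "X = \<alpha> (Suc i) - h * D i"
    have X: "graded_mat n (s (Suc i)) (s (Suc i)) X"
      unfolding X_def by (intro graded_mat_minus graded_mat_mult[OF h] \<alpha> D_graded)
    have "D i * X = D i * \<alpha> (Suc i) - D i * (h * D i)"
      unfolding X_def using c by (intro mult_minus_distrib_mat) auto
    also have "D i * \<alpha> (Suc i) = (D i * h) * D i + N * D i"
      unfolding \<alpha>(2) eq using c N by (intro add_mult_distrib_mat) auto
    also have "(D i * h) * D i = D i * (h * D i)"
      using c by (intro assoc_mult_mat) auto
    also have "D i * (h * D i) + N * D i - D i * (h * D i) = 0\<^sub>m (length (s i)) (length (s (Suc i)))"
      unfolding ND using c by (intro eq_matI) auto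
    finally have "\<And>l. l < length (s (Suc i)) \<Longrightarrow> cycle I e D (Suc i) (col X l)"
      using graded_mat_carrier[OF X] by (intro cycle_Suc_col) auto
    from lift_mat[OF X this] obtain k where
      k: "graded_mat n (s (Suc (Suc i))) (s (Suc i)) k" "D (Suc i) * k = X" by blast
    have "\<alpha> (Suc i) = D (Suc i) * k + h * D i"
      unfolding k X_def using c(1) c(2)[of "Suc i"] by (intro eq_matI) auto
    moreover have "h * D i * D (Suc i) = 0\<^sub>m (length (s (Suc i))) (length (s (Suc (Suc i))))"
      using assoc_mult_mat[OF c(1) D_carrier D_carrier] DD c(1) by simp
    moreover have "const_mat (h * D i) = 0\<^sub>m (length (s (Suc i))) (length (s (Suc i)))"
      using c by (intro mult_right_const_0[OF _ _ min]) auto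
    ultimately show ?case
      using k(1) c(1) by (intro exI[of _ k] exI[of _ "h * D i"]) auto
  qed
  then obtain h N where h: "graded_mat n (s (Suc i)) (s i) h" and N: "N \<in> carrier_mat (length (s i)) (length (s i))"
    and eq: "\<alpha> i = D i * h + N" and N0: "const_mat N = 0\<^sub>m (length (s i)) (length (s i))" by blast
  have "const_mat (D i * h) = 0\<^sub>m (length (s i)) (length (s i))"
    using graded_mat_carrier[OF h] by (intro mult_left_const_0[OF _ _ min]) auto
  moreover have "const_mat (D i * h + N) = const_mat (D i * h) + const_mat N"
    using N graded_mat_carrier[OF h] by (intro eq_matI) (auto simp: lookup_add)
  ultimately show ?thesis unfolding eq N0 by simp
qed

text \<open>
  A trace argument would only give the equality of dimensions modulo the characteristic.
\<close>

lemma card_le_of_left_inverse: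
  fixes P :: "'j \<Rightarrow> 'i \<Rightarrow> 'a::field" and Q :: "'i \<Rightarrow> 'j \<Rightarrow> 'a"
  assumes fin: "finite S" "finite T"
    and inv: "\<And>a b. a \<in> S \<Longrightarrow> b \<in> S \<Longrightarrow> (\<Sum>j\<in>T. Q a j * P j b) = (if a = b then 1 else 0)"
  shows "card S \<le> card T"
proof (rule ccontr)
  assume "\<not> card S \<le> card T"
  then have less: "card T < card S" by simp
  obtain f where f: "bij_betw f {0..<card S} S" using ex_bij_betw_nat_finite[OF fin(1)] by blast
  obtain g where g: "bij_betw g {0..<card T} T" using ex_bij_betw_nat_finite[OF fin(2)] by blast
  \<comment> \<open>Both matrices are padded by zeros to size \<open>card S\<close>. Square matrices
    with \<open>A * B = 1\<close> also satisfy \<open>B * A = 1\<close>, but row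
    \<open>card T\<close> of \<open>B\<close> is zero.\<close>
  define A where "A = mat (card S) (card S) (\<lambda>(i, j). if j < card T then Q (f i) (g j) else 0)"
  define B where "B = mat (card S) (card S) (\<lambda>(i, j). if i < card T then P (g i) (f j) else 0)"
  have AB: "A \<in> carrier_mat (card S) (card S)" "B \<in> carrier_mat (card S) (card S)"
    by (simp_all add: A_def B_def)
  have "A * B = 1\<^sub>m (card S)"
  proof (rule eq_matI)
    fix i j assume "i < dim_row (1\<^sub>m (card S) :: 'a mat)" "j < dim_col (1\<^sub>m (card S) :: 'a mat)"
    then have ij: "i < card S" "j < card S" by simp_all
    have "(A * B) $$ (i, j) = (\<Sum>k\<in>{0..<card S}. if k < card T then Q (f i) (g k) * P (g k) (f j) else 0)"
      using ij by (auto simp: A_def B_def scalar_prod_def intro!: sum.cong)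
    also have "\<dots> = (\<Sum>k\<in>{0..<card T}. Q (f i) (g k) * P (g k) (f j))"
      using less by (intro sum.mono_neutral_cong_right) auto
    also have "\<dots> = (\<Sum>k\<in>T. Q (f i) k * P k (f j))"
      by (rule sum.reindex_bij_betw[OF g])
    also have "\<dots> = (if f i = f j then 1 else 0)"
      using ij f by (intro inv) (auto simp: bij_betw_def)
    also have "\<dots> = 1\<^sub>m (card S) $$ (i, j)"
      using ij f by (auto simp: bij_betw_def inj_on_def)
    finally show "(A * B) $$ (i, j) = 1\<^sub>m (card S) $$ (i, j)" .
  qed (use AB in auto)
  from mat_mult_left_right_inverse[OF AB this] have BA: "B * A = 1\<^sub>m (card S)" .
  have "(B * A) $$ (card T, card T) = 0"
    using less by (simp add: A_def B_def scalar_prod_def)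
  then show False unfolding BA using less by simp
qed

lemma count_list_card: "count_list xs d = card {i. i < length xs \<and> xs ! i = d}"
  by (simp add: count_list_eq_length_filter length_filter_conv_card eq_commute)

text \<open>Restricting the reduced matrices to basis elements of degree \<open>d\<close> keeps the
  left inverse relation, so the number of these elements cannot drop from \<open>s\<close> to
  \<open>t\<close>.\<close>

lemma count_list_le_of_left_inverse:
  assumes \<phi>: "graded_mat n t s \<phi>" and \<psi>: "\<psi> \<in> carrier_mat (length s) (length t)"
    and inv: "const_mat (\<psi> * \<phi>) = 1\<^sub>m (length s)"
  shows "count_list s d \<le> count_list t d"
  unfolding count_list_card
proof (rule card_le_of_left_inverse)
  let ?Q = "\<lambda>i j. const_mat \<psi> $$ (i, j)" and ?P = "\<lambda>j i. const_mat \<phi> $$ (j, i)"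
  fix a b assume ab: "a \<in> {i. i < length s \<and> s ! i = d}" "b \<in> {i. i < length s \<and> s ! i = d}"
  note c = graded_mat_carrier[OF \<phi>] \<psi>
  \<comment> \<open>Indices \<open>j\<close> of another degree contribute 0, since the constant term
    of \<open>\<phi>\<close> there vanishes by homogeneity.\<close>
  have "(\<Sum>j | j < length t \<and> t ! j = d. ?Q a j * ?P j b) = (\<Sum>j\<in>{0..<length t}. ?Q a j * ?P j b)"
    using graded_mat_const[OF \<phi>] ab by (intro sum.mono_neutral_left) auto
  also have "\<dots> = (const_mat \<psi> * const_mat \<phi>) $$ (a, b)"
    using c ab by (auto simp: scalar_prod_def intro!: sum.cong)
  also have "\<dots> = 1\<^sub>m (length s) $$ (a, b)"
    using inv const.mat_hom_mult[OF \<psi> graded_mat_carrier[OF \<phi>]] by simp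
  finally show "(\<Sum>j | j < length t \<and> t ! j = d. ?Q a j * ?P j b) = (if a = b then 1 else 0)"
    using ab by simp
qed auto

text \<open>Adjointness of \<open>A\<close> and its transpose; the vector on the right is the
  transpose applied to \<open>e\<close>.\<close>

lemma scalar_prod_mult_mat_vec:
  fixes e :: "'a::comm_semiring_0 vec"
  assumes "A \<in> carrier_mat a b" "e \<in> carrier_vec a" "w \<in> carrier_vec b"
  shows "e \<bullet> (A *\<^sub>v w) = vec b (\<lambda>l. e \<bullet> col A l) \<bullet> w"
proof -
  have "vec b (\<lambda>l. e \<bullet> col A l) = A\<^sup>T *\<^sub>v e"
    using assms comm_scalar_prod[of e a] by (intro eq_vecI) auto
  then show ?thesis using transpose_vec_mult_scalar[OF assms(1,3,2)] by simp
qed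

text \<open>Basis elements in degree 0 go to homogeneous lifts of their classes in
  \<open>R/I\<close>. The last conclusion says that the chain map covers the identity of
  \<open>R/I\<close>.\<close>

lemma comparison_resolutions:
  assumes "resolution I n s e D" "resolution I n t f E"
  obtains \<phi> where "\<And>i. graded_mat n (s i) (t i) (\<phi> i)" "\<And>i. D i * \<phi> (Suc i) = \<phi> i * E i"
    "\<And>w. w \<in> free_module n (length (t 0)) \<Longrightarrow> e \<bullet> (\<phi> 0 *\<^sub>v w) - f \<bullet> w \<in> I"
proof -
  interpret F: resolution I n s e D by fact
  interpret G: resolution I n t f E by fact
  have "\<exists>v. graded_vec n (s 0) (t 0 ! l) v \<and> e \<bullet> v - f $ l \<in> I" if "l < length (t 0)" for l
    using that G.e_mem G.e_homogeneous by (intro F.augmentation_lift) (auto simp: free_module_iff)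
  then obtain v where v: "\<And>l. l < length (t 0) \<Longrightarrow> graded_vec n (s 0) (t 0 ! l) (v l) \<and> e \<bullet> v l - f $ l \<in> I"
    by metis
  define \<phi>0 where "\<phi>0 = mat (length (s 0)) (length (t 0)) (\<lambda>(j, l). v l $ j)"
  have \<phi>0: "graded_mat n (s 0) (t 0) \<phi>0"
    using v by (auto simp: \<phi>0_def graded_mat_def graded_vec_def free_module_iff)
  note c = graded_mat_carrier[OF \<phi>0]
  have col: "col \<phi>0 l = v l" if "l < length (t 0)" for l
    using v[OF that] that by (intro eq_vecI) (auto simp: \<phi>0_def graded_vec_def free_module_iff)
  have aug: "e \<bullet> (\<phi>0 *\<^sub>v w) - f \<bullet> w \<in> I" if w: "w \<in> free_module n (length (t 0))" for w
  proof -
    have "e \<bullet> (\<phi>0 *\<^sub>v w) - f \<bullet> w = (\<Sum>l\<in>{0..<length (t 0)}. w $ l * (e \<bullet> v l - f $ l))"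
      using w c by (subst scalar_prod_mult_mat_vec[OF c])
        (auto simp: free_module_iff scalar_prod_def[of _ w] sum_subtractf[symmetric] col algebra_simps intro!: sum.cong)
    then show ?thesis using v w by (auto intro!: F.sum_mem F.mult_mem simp: free_module_iff)
  qed
  \<comment> \<open>The augmentation \<open>f\<close> sends the image of \<open>E 0\<close> into
    \<open>I\<close>, and \<open>e\<close> after \<open>\<phi>0\<close> agrees with \<open>f\<close>
    modulo \<open>I\<close>.\<close>
  have "cycle I e D 0 (col (\<phi>0 * E 0) l)" if l: "l < length (t (Suc 0))" for l
  proof -
    have w: "col (E 0) l \<in> free_module n (length (t 0))"
      using graded_mat_col[OF G.D_graded l] by (simp add: graded_vec_def)
    have "unit_vec (length (t (Suc 0))) l \<in> free_module n (length (t (Suc 0)))"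
      by (simp add: free_module_iff unit_vec_def)
    from G.cycle_D[OF this] have "f \<bullet> col (E 0) l \<in> I"
      using mult_mat_unit_vec[OF G.D_carrier l] by (simp add: cycle_def)
    then have "e \<bullet> (\<phi>0 *\<^sub>v col (E 0) l) \<in> I" using aug[OF w] F.mem_cong by blast
    then show ?thesis using col_mult2[OF c G.D_carrier l] by (simp add: cycle_def)
  qed
  from F.comparison[OF G.D_graded G.DD \<phi>0 this] obtain \<phi> where "\<phi> 0 = \<phi>0"
    "\<And>i. graded_mat n (s i) (t i) (\<phi> i)" "\<And>i. D i * \<phi> (Suc i) = \<phi> i * E i" by metis
  then show ?thesis using aug that by blast
qed

text \<open>The composite \<open>\<psi> i * \<phi> i\<close> covers the identity of
  \<open>R/I\<close>, so it differs from the identity by a nullhomotopic map. As \<open>D\<close> is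
  minimal, this difference has zero constant part, and \<open>\<phi> i\<close> becomes left
  invertible over the field.\<close>

lemma minimal_count_le:
  assumes I: "graded_ideal I n"
    and s: "minimal_graded_free_resolution n I s e D"
    and t: "graded_free_resolution n I t f E"
  shows "count_list (s i) d \<le> count_list (t i) d"
proof -
  interpret F: resolution I n s e D
    using I s by (auto simp: resolution_def resolution_axioms_def minimal_graded_free_resolution_def)
  interpret G: resolution I n t f E
    using I t by (auto simp: resolution_def resolution_axioms_def)
  obtain \<psi> where \<psi>: "\<And>i. graded_mat n (s i) (t i) (\<psi> i)" "\<And>i. D i * \<psi> (Suc i) = \<psi> i * E i"
    "\<And>w. w \<in> free_module n (length (t 0)) \<Longrightarrow> e \<bullet> (\<psi> 0 *\<^sub>v w) - f \<bullet> w \<in> I"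
    using comparison_resolutions[OF F.resolution_axioms G.resolution_axioms] by metis
  obtain \<phi> where \<phi>: "\<And>i. graded_mat n (t i) (s i) (\<phi> i)" "\<And>i. E i * \<phi> (Suc i) = \<phi> i * D i"
    "\<And>w. w \<in> free_module n (length (s 0)) \<Longrightarrow> f \<bullet> (\<phi> 0 *\<^sub>v w) - e \<bullet> w \<in> I"
    using comparison_resolutions[OF G.resolution_axioms F.resolution_axioms] by metis
  have c: "\<psi> i \<in> carrier_mat (length (s i)) (length (t i))" "\<phi> i \<in> carrier_mat (length (t i)) (length (s i))" for i
    using graded_mat_carrier \<psi>(1) \<phi>(1) by blast+
  define \<alpha> where "\<alpha> i = \<psi> i * \<phi> i - 1\<^sub>m (length (s i))" for i
  have \<alpha>: "graded_mat n (s i) (s i) (\<alpha> i)" for i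
    unfolding \<alpha>_def by (intro graded_mat_minus graded_mat_mult[OF \<psi>(1) \<phi>(1)] graded_mat_one)
  have comm: "D i * \<alpha> (Suc i) = \<alpha> i * D i" for i
  proof -
    have "D i * (\<psi> (Suc i) * \<phi> (Suc i)) = \<psi> i * \<phi> i * D i"
      using assoc_mult_mat[OF F.D_carrier c(1) c(2)] \<psi>(2) assoc_mult_mat[OF c(1) G.D_carrier c(2)]
        \<phi>(2) assoc_mult_mat[OF c(1) c(2) F.D_carrier] by metis
    then show ?thesis
      unfolding \<alpha>_def using c
      by (simp add: mult_minus_distrib_mat[OF F.D_carrier mult_carrier_mat[OF c(1) c(2)]]
          minus_mult_distrib_mat[OF mult_carrier_mat[OF c(1) c(2)] one_carrier_mat F.D_carrier])
  qed
  have "cycle I e D 0 (col (\<alpha> 0) l)" if l: "l < length (s 0)" for l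
  proof -
    let ?u = "unit_vec (length (s 0)) l"
    have u: "?u \<in> free_module n (length (s 0))" by (simp add: free_module_iff unit_vec_def)
    have w: "\<phi> 0 *\<^sub>v ?u \<in> free_module n (length (t 0))" using u by (intro mult_free_module[OF \<phi>(1)])
    have v: "\<psi> 0 *\<^sub>v (\<phi> 0 *\<^sub>v ?u) \<in> carrier_vec (length (s 0))"
      by (rule mult_mat_vec_carrier[OF c(1) mult_mat_vec_carrier[OF c(2) unit_vec_carrier]])
    have "col (\<alpha> 0) l = \<alpha> 0 *\<^sub>v ?u"
      using mult_mat_unit_vec[OF graded_mat_carrier[OF \<alpha>] l] by simp
    also have "\<dots> = \<psi> 0 *\<^sub>v (\<phi> 0 *\<^sub>v ?u) - ?u"
      unfolding \<alpha>_def
        minus_mult_distrib_mat_vec[OF mult_carrier_mat[OF c(1) c(2)] one_carrier_mat unit_vec_carrier]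
        assoc_mult_mat_vec[OF c(1) c(2) unit_vec_carrier]
      by simp
    finally have "e \<bullet> col (\<alpha> 0) l = e \<bullet> (\<psi> 0 *\<^sub>v (\<phi> 0 *\<^sub>v ?u)) - e \<bullet> ?u"
      using v by (simp add: scalar_prod_minus_distrib[of e "length (s 0)"])
    \<comment> \<open>Inserting the value of \<open>f\<close> on the intermediate vector splits the
      defect of the composite into the defects of \<open>\<psi>\<close> and \<open>\<phi>\<close>,
      each in \<open>I\<close>.\<close>
    also have "\<dots> = (e \<bullet> (\<psi> 0 *\<^sub>v (\<phi> 0 *\<^sub>v ?u)) - f \<bullet> (\<phi> 0 *\<^sub>v ?u)) + (f \<bullet> (\<phi> 0 *\<^sub>v ?u) - e \<bullet> ?u)"
      by simp
    also have "\<dots> \<in> I" by (intro F.add_mem \<psi>(3)[OF w] \<phi>(3)[OF u])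
    finally show ?thesis by (simp add: cycle_def)
  qed
  then have "const_mat (\<alpha> i) = 0\<^sub>m (length (s i)) (length (s i))"
    using F.nullhomotopic_const[OF minimal_const[OF s] \<alpha> comm] by blast
  then have "const_mat (\<psi> i * \<phi> i) = 1\<^sub>m (length (s i))"
  proof (intro eq_matI)
    fix j l
    assume 0: "const_mat (\<alpha> i) = 0\<^sub>m (length (s i)) (length (s i))"
      and "j < dim_row (1\<^sub>m (length (s i)) :: 'a mat)" "l < dim_col (1\<^sub>m (length (s i)) :: 'a mat)"
    then have jl: "j < length (s i)" "l < length (s i)" by simp_all
    have "const_mat (\<alpha> i) $$ (j, l) = const_mat (\<psi> i * \<phi> i) $$ (j, l) - 1\<^sub>m (length (s i)) $$ (j, l)"
      using jl c[of i] by (simp add: \<alpha>_def lookup_minus)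
    then show "const_mat (\<psi> i * \<phi> i) $$ (j, l) = 1\<^sub>m (length (s i)) $$ (j, l)"
      using 0 jl by simp
  qed (use c in auto)
  then show ?thesis by (intro count_list_le_of_left_inverse[OF \<phi>(1) c(1)])
qed

text \<open>Two minimal resolutions bound each other's counts by \<open>minimal_count_le\<close>, so
  the definite description has exactly one value.\<close>

lemma graded_betti_eq:
  assumes "graded_ideal I n" "minimal_graded_free_resolution n I s e D" "r \<ge> 0" "d \<ge> 0"
  shows "graded_betti n I r d = count_list (s (nat r)) d"
proof -
  have unique: "count_list (t (nat r)) d = count_list (s (nat r)) d"
    if "minimal_graded_free_resolution n I t f E" for t f E
    using minimal_count_le[OF assms(1), of s e D t f E] minimal_count_le[OF assms(1), of t f E s e D]
      assms(2) that unfolding minimal_graded_free_resolution_def by (simp add: order_antisym)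
  have "(THE b. \<exists>s e D. minimal_graded_free_resolution n I s e D \<and> b = count_list (s (nat r)) d)
      = count_list (s (nat r)) d"
  proof (rule the_equality)
    show "\<exists>t f E. minimal_graded_free_resolution n I t f E \<and> count_list (s (nat r)) d = count_list (t (nat r)) d"
      using assms(2) by blast
  qed (use unique in blast)
  then show ?thesis
    using assms(3,4) by (simp add: graded_betti_def)
qed

section \<open>Mapping cones\<close>

text \<open>
  Nonnegativity of the degrees matches the convention that \<open>graded_betti\<close> is 0 in negative
  internal degrees, which occur in the recursion as \<open>d - p\<close>.
\<close>

definition resolved :: "nat \<Rightarrow> 'a::field mpoly set \<Rightarrow> (nat \<Rightarrow> int list) \<Rightarrow> bool" where
  "resolved n I s \<longleftrightarrow> graded_ideal I n \<and> s 0 = [0] \<and> (\<forall>i. \<forall>x\<in>set (s i). 0 \<le> x) \<and>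
    (\<exists>D. minimal_graded_free_resolution n I s (unit_vec 1 0) D)"

section \<open>Block vectors and block matrices\<close>

lemma free_module_append:
  "u @\<^sub>v w \<in> free_module n (a + b) \<longleftrightarrow> u \<in> free_module n a \<and> w \<in> free_module n b"
  if "u \<in> carrier_vec a" "w \<in> carrier_vec b"
proof -
  have "(\<forall>j<a + b. (u @\<^sub>v w) $ j \<in> polys n) \<longleftrightarrow> (\<forall>j<a. u $ j \<in> polys n) \<and> (\<forall>j<b. w $ j \<in> polys n)"
  proof (intro iffI conjI allI impI)
    assume *: "\<forall>j<a + b. (u @\<^sub>v w) $ j \<in> polys n"
    show "u $ j \<in> polys n" if "j < a" for j
      using *[rule_format, of j] that \<open>u \<in> _\<close> \<open>w \<in> _\<close> by simp
    show "w $ j \<in> polys n" if "j < b" for j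
      using *[rule_format, of "a + j"] that \<open>u \<in> _\<close> \<open>w \<in> _\<close> by simp
  next
    fix j assume "(\<forall>j<a. u $ j \<in> polys n) \<and> (\<forall>j<b. w $ j \<in> polys n)" "j < a + b"
    then show "(u @\<^sub>v w) $ j \<in> polys n" using that by auto
  qed
  then show ?thesis using that by (simp add: free_module_iff)
qed

lemma free_module_split:
  assumes "v \<in> free_module n (a + b)"
  obtains u w where "u \<in> free_module n a" "w \<in> free_module n b" "v = u @\<^sub>v w"
proof (rule that)
  have v: "v = vec_first v a @\<^sub>v vec_last v b"
    using assms by (simp add: free_module_iff)
  then show "v = vec_first v a @\<^sub>v vec_last v b" .
  show "vec_first v a \<in> free_module n a" "vec_last v b \<in> free_module n b"
    using assms v free_module_append[of "vec_first v a" a "vec_last v b" b n] by simp_all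
qed

lemma graded_four_block_mat:
  assumes "graded_mat n s u A" "graded_mat n s v B" "graded_mat n t u C" "graded_mat n t v E"
  shows "graded_mat n (s @ t) (u @ v) (four_block_mat A B C E)"
proof -
  have "A \<in> carrier_mat (length s) (length u)" "E \<in> carrier_mat (length t) (length v)"
    using assms by (simp_all add: graded_mat_def)
  then show ?thesis
    using assms by (auto simp: graded_mat_def nth_append)
qed

lemma graded_smult:
  assumes "graded_mat n s (map ((+) a) t) A" "y \<in> polys n" "homogeneous b y"
  shows "graded_mat n s (map ((+) (a + b)) t) (y \<cdot>\<^sub>m A)"
  unfolding graded_mat_def
proof (intro conjI allI impI)
  fix j l assume jl: "j < length s" "l < length (map ((+) (a + b)) t)"
  then have *: "A $$ (j, l) \<in> polys n" "homogeneous (a + t ! l - s ! j) (A $$ (j, l))"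
    and A: "(y \<cdot>\<^sub>m A) $$ (j, l) = y * A $$ (j, l)"
    using assms(1) by (auto simp: graded_mat_def)
  show "(y \<cdot>\<^sub>m A) $$ (j, l) \<in> polys n" unfolding A using * assms by simp
  show "homogeneous (map ((+) (a + b)) t ! l - s ! j) ((y \<cdot>\<^sub>m A) $$ (j, l))"
    unfolding A using jl by (intro homogeneous_mult[OF assms(3) *(2)]) simp
qed (use graded_mat_carrier[OF assms(1)] in simp)

section \<open>The cone of a multiplication map\<close>

text \<open>Behind this is the exact sequence from \<open>R/K\<close>, shifted by
  \<open>a + b\<close>, via multiplication by \<open>y * g\<close> to \<open>R/I\<close> and on to
  \<open>R/J\<close>. Here \<open>K_I\<close> lets \<open>g\<close> map \<open>R/K\<close> to
  \<open>R/I\<close>, \<open>colon\<close> gives injectivity, and \<open>sum\<close> says that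
  \<open>J\<close> is \<open>I\<close> plus the ideal of \<open>y * g\<close>.\<close>

lemma resolved_cone:
  assumes I: "resolved n I s" and K: "resolved n K t" and J: "graded_ideal J n"
    and y: "y \<in> irrelevant_ideal n" "homogeneous b y"
    and g: "g \<in> polys n" "homogeneous a g"
    and K_I: "\<And>f. f \<in> K \<Longrightarrow> f * g \<in> I"
    and colon: "\<And>f. f \<in> polys n \<Longrightarrow> f * (y * g) \<in> I \<Longrightarrow> f \<in> K"
    and sum: "\<And>f. f \<in> polys n \<Longrightarrow> f \<in> J \<longleftrightarrow> (\<exists>h\<in>polys n. f - h * (y * g) \<in> I)"
    and "0 \<le> a" "0 \<le> b"
  shows "resolved n J (\<lambda>i. s i @ (case i of 0 \<Rightarrow> [] | Suc k \<Rightarrow> map ((+) (a + b)) (t k)))"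
proof -
  let ?e = "unit_vec 1 0 :: 'a mpoly vec"
  obtain D where D: "minimal_graded_free_resolution n I s ?e D" using I by (auto simp: resolved_def)
  obtain E where E: "minimal_graded_free_resolution n K t ?e E" using K by (auto simp: resolved_def)
  have s0: "s 0 = [0]" and t0: "t 0 = [0]" using I K by (simp_all add: resolved_def)
  interpret F: resolution I n s ?e D
    using I D by (auto simp: resolved_def resolution_def resolution_axioms_def minimal_graded_free_resolution_def)
  interpret G: resolution K n t ?e E
    using K E by (auto simp: resolved_def resolution_def resolution_axioms_def minimal_graded_free_resolution_def)
  interpret J: graded_ideal J n by fact
  interpret irr: graded_ideal "irrelevant_ideal n" n by (rule graded_ideal_irrelevant)
  have e: "?e \<bullet> v = v $ 0" if "v \<in> carrier_vec (Suc 0)" for v :: "'a mpoly vec"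
    using that by (simp add: scalar_prod_def)
  have y_poly: "y \<in> polys n" using y by (intro irr.subset)

  \<comment> \<open>In homological degree 0 both modules have rank 1, and the lift is multiplication
    by \<open>g\<close>.\<close>
  define \<phi>0 where "\<phi>0 = mat 1 1 (\<lambda>_. g)"
  have \<phi>0: "graded_mat n (s 0) (map ((+) a) (t 0)) \<phi>0"
    using g by (simp add: \<phi>0_def graded_mat_def s0 t0)
  have "cycle I ?e D 0 (col (\<phi>0 * E 0) l)" if "l < length (map ((+) a) (t (Suc 0)))" for l
  proof -
    have l: "l < length (t (Suc 0))" using that by simp
    have cE: "E 0 \<in> carrier_mat 1 (length (t (Suc 0)))" using G.D_carrier[of 0] by (simp add: t0)
    have "unit_vec (length (t (Suc 0))) l \<in> free_module n (length (t (Suc 0)))"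
      by (simp add: free_module_iff unit_vec_def)
    from G.cycle_D[OF this] have "?e \<bullet> col (E 0) l \<in> K"
      unfolding mult_mat_unit_vec[OF G.D_carrier l] by (simp add: cycle_def)
    then have "E 0 $$ (0, l) \<in> K" using l cE by (subst (asm) e) auto
    then have "E 0 $$ (0, l) * g \<in> I" by (rule K_I)
    moreover have "col (\<phi>0 * E 0) l = vec 1 (\<lambda>_. E 0 $$ (0, l) * g)"
      using cE l by (intro eq_vecI) (auto simp: \<phi>0_def scalar_prod_def)
    ultimately show ?thesis by (simp add: cycle_def e)
  qed
  moreover have "graded_mat n (map ((+) a) (t i)) (map ((+) a) (t (Suc i))) (E i)" for i
    by (rule graded_mat_shift[OF G.D_graded])
  moreover have "E i * E (Suc i) = 0\<^sub>m (length (map ((+) a) (t i))) (length (map ((+) a) (t (Suc (Suc i)))))" for i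
    using G.DD by simp
  ultimately obtain \<phi> where \<phi>_0: "\<phi> 0 = \<phi>0" and \<phi>: "\<And>i. graded_mat n (s i) (map ((+) a) (t i)) (\<phi> i)"
    and D\<phi>: "\<And>i. D i * \<phi> (Suc i) = \<phi> i * E i"
    using F.comparison[of "\<lambda>i. map ((+) a) (t i)" E \<phi>0] \<phi>0 by metis
  have \<phi>c: "\<phi> i \<in> carrier_mat (length (s i)) (length (t i))" for i
    using graded_mat_carrier[OF \<phi>] by simp

  \<comment> \<open>The resolution of \<open>R/K\<close> moved up by one homological degree and by
    \<open>a + b\<close> internally; it contributes nothing to degree 0.\<close>
  define t' where "t' i = (case i of 0 \<Rightarrow> [] | Suc k \<Rightarrow> map ((+) (a + b)) (t k))" for i
  \<comment> \<open>Lifting \<open>g\<close> instead of \<open>y * g\<close> and multiplying by \<open>y\<close> afterwards makes the cone minimal.\<close>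
  define Y where "Y i = y \<cdot>\<^sub>m \<phi> i" for i
  \<comment> \<open>The shifted differential. Its sign makes the mixed terms of two consecutive cone
    differentials cancel; the \<open>0\<close> by \<open>1\<close> matrix fits the empty
    \<open>t' 0\<close> and the single generator in \<open>t 0\<close>.\<close>
  define \<Delta> where "\<Delta> i = (case i of 0 \<Rightarrow> 0\<^sub>m 0 1 | Suc k \<Rightarrow> - E k)" for i
  define C where "C i = four_block_mat (D i) (Y i) (0\<^sub>m (length (t' i)) (length (s (Suc i)))) (\<Delta> i)" for i
  have Yc: "Y i \<in> carrier_mat (length (s i)) (length (t i))" for i
    using \<phi>c by (simp add: Y_def)
  have Y: "graded_mat n (s i) (t' (Suc i)) (Y i)" for i
    using graded_smult[OF \<phi> y_poly y(2)] by (simp add: Y_def t'_def)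
  have \<Delta>: "graded_mat n (t' i) (t' (Suc i)) (\<Delta> i)" for i
  proof (cases i)
    case 0
    then show ?thesis by (simp add: \<Delta>_def t'_def graded_mat_def t0)
  next
    case (Suc k)
    then show ?thesis
      using graded_mat_uminus[OF graded_mat_shift[OF G.D_graded]] by (simp add: \<Delta>_def t'_def)
  qed
  have \<Delta>c: "\<Delta> i \<in> carrier_mat (length (t' i)) (length (t i))" for i
    using graded_mat_carrier[OF \<Delta>[of i]] by (simp add: t'_def)
  have C: "graded_mat n (s i @ t' i) (s (Suc i) @ t' (Suc i)) (C i)" for i
    unfolding C_def by (intro graded_four_block_mat F.D_graded Y \<Delta> graded_mat_zero)
  have C_mult: "C i *\<^sub>v (u @\<^sub>v w) = (D i *\<^sub>v u + Y i *\<^sub>v w) @\<^sub>v (\<Delta> i *\<^sub>v w)"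
    if "u \<in> carrier_vec (length (s (Suc i)))" "w \<in> carrier_vec (length (t i))" for i u w
  proof -
    have "0\<^sub>m (length (t' i)) (length (s (Suc i))) *\<^sub>v u + \<Delta> i *\<^sub>v w = \<Delta> i *\<^sub>v w"
      using that \<Delta>c[of i] by (intro eq_vecI) auto
    then show ?thesis
      unfolding C_def
      by (subst four_block_mat_mult_vec[OF F.D_carrier Yc _ \<Delta>c that]) simp_all
  qed
  have DY: "D i *\<^sub>v (Y (Suc i) *\<^sub>v w) = Y i *\<^sub>v (E i *\<^sub>v w)" if w: "w \<in> carrier_vec (length (t (Suc i)))" for i w
  proof -
    have "D i * Y (Suc i) = y \<cdot>\<^sub>m (D i * \<phi> (Suc i))"
      unfolding Y_def by (rule mult_smult_distrib[OF F.D_carrier \<phi>c])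
    also have "\<dots> = Y i * E i"
      unfolding Y_def D\<phi> by (rule mult_smult_assoc_mat[OF \<phi>c G.D_carrier, symmetric])
    finally show ?thesis
      using assoc_mult_mat_vec[OF F.D_carrier Yc w] assoc_mult_mat_vec[OF Yc G.D_carrier w] by simp
  qed
  have Y0: "Y 0 *\<^sub>v w = vec 1 (\<lambda>_. w $ 0 * (y * g))" if "w \<in> carrier_vec (Suc 0)" for w
    using that by (intro eq_vecI) (auto simp: Y_def \<phi>_0 \<phi>0_def scalar_prod_def)

  \<comment> \<open>Exactness of the cone in block form: the pair \<open>u\<close>, \<open>w\<close>
    is a cycle iff both blocks come from a common pair \<open>u'\<close>, \<open>w'\<close>.\<close>
  have exact: "cycle J ?e C i (u @\<^sub>v w) \<longleftrightarrow>
      (\<exists>u'\<in>free_module n (length (s (Suc i))). \<exists>w'\<in>free_module n (length (t i)).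
        u = D i *\<^sub>v u' + Y i *\<^sub>v w' \<and> w = \<Delta> i *\<^sub>v w')"
    if u: "u \<in> free_module n (length (s i))" and w: "w \<in> free_module n (length (t' i))" for i u w
  proof (cases i)
    case 0
    have uc: "u \<in> carrier_vec 1" "u $ 0 \<in> polys n" and wc: "w \<in> carrier_vec 0"
      using u w 0 by (auto simp: free_module_iff s0 t'_def)
    have "u @\<^sub>v w \<in> carrier_vec (1 + 0)"
      using uc wc by (intro append_carrier_vec)
    then have "?e \<bullet> (u @\<^sub>v w) = u $ 0"
      using uc wc by (subst e) auto
    then have "cycle J ?e C i (u @\<^sub>v w) \<longleftrightarrow> u $ 0 \<in> J" using 0 by (simp add: cycle_def)
    also have "\<dots> \<longleftrightarrow> (\<exists>h\<in>polys n. u $ 0 - h * (y * g) \<in> I)" by (rule sum[OF uc(2)])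
    also have "\<dots> \<longleftrightarrow> (\<exists>u'\<in>free_module n (length (s (Suc i))). \<exists>w'\<in>free_module n (length (t i)).
        u = D i *\<^sub>v u' + Y i *\<^sub>v w' \<and> w = \<Delta> i *\<^sub>v w')"
    proof
      assume "\<exists>h\<in>polys n. u $ 0 - h * (y * g) \<in> I"
      then obtain h where h: "h \<in> polys n" "u $ 0 - h * (y * g) \<in> I" by blast
      \<comment> \<open>The cofactor \<open>h\<close> of \<open>y * g\<close> becomes the new
        coordinate; what remains of \<open>u\<close> lies in \<open>I\<close> and is a boundary of
        \<open>D 0\<close>.\<close>
      let ?w = "vec 1 (\<lambda>_. h)"
      have "u - Y 0 *\<^sub>v ?w \<in> free_module n (length (s 0))"
        using uc h y_poly g by (subst Y0) (auto simp: free_module_iff s0)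
      moreover have "cycle I ?e D 0 (u - Y 0 *\<^sub>v ?w)"
        using uc h by (subst Y0) (auto simp: cycle_def e)
      ultimately obtain u' where u': "u' \<in> free_module n (length (s (Suc 0)))" "u - Y 0 *\<^sub>v ?w = D 0 *\<^sub>v u'"
        using F.exact by blast
      have "u = D 0 *\<^sub>v u' + Y 0 *\<^sub>v ?w"
        unfolding u'(2)[symmetric] using uc by (subst (1 2) Y0) auto
      moreover have "w = \<Delta> 0 *\<^sub>v ?w" using wc by (auto simp: \<Delta>_def)
      moreover have "?w \<in> free_module n (length (t 0))" using h by (simp add: free_module_iff t0)
      ultimately show "\<exists>u'\<in>free_module n (length (s (Suc i))). \<exists>w'\<in>free_module n (length (t i)).
        u = D i *\<^sub>v u' + Y i *\<^sub>v w' \<and> w = \<Delta> i *\<^sub>v w'"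
        using u' 0 by blast
    next
      assume "\<exists>u'\<in>free_module n (length (s (Suc i))). \<exists>w'\<in>free_module n (length (t i)).
        u = D i *\<^sub>v u' + Y i *\<^sub>v w' \<and> w = \<Delta> i *\<^sub>v w'"
      then obtain u' w' where u': "u' \<in> free_module n (length (s (Suc 0)))" and
        w': "w' \<in> free_module n (length (t 0))" and eq: "u = D 0 *\<^sub>v u' + Y 0 *\<^sub>v w'"
        using 0 by blast
      have "D 0 *\<^sub>v u' \<in> carrier_vec (Suc 0)"
        using u' mult_mat_vec_carrier[OF F.D_carrier[of 0]] by (simp add: free_module_iff s0)
      then have "(D 0 *\<^sub>v u') $ 0 \<in> I"
        using F.cycle_D[OF u'] by (simp add: cycle_def e)
      moreover have "u $ 0 = (D 0 *\<^sub>v u') $ 0 + w' $ 0 * (y * g)"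
        unfolding eq using w' by (subst Y0) (auto simp: free_module_iff t0 s0)
      ultimately show "\<exists>h\<in>polys n. u $ 0 - h * (y * g) \<in> I"
        using w' by (intro bexI[of _ "w' $ 0"]) (auto simp: free_module_iff t0)
    qed
    finally show ?thesis .
  next
    case (Suc k)
    have uc: "u \<in> carrier_vec (length (s (Suc k)))" and wm: "w \<in> free_module n (length (t k))"
      using u w Suc by (auto simp: free_module_iff t'_def)
    then have wc: "w \<in> carrier_vec (length (t k))" by (simp add: free_module_iff)
    have "dim_row (C k) = length (s k) + length (t' k)"
      using graded_mat_carrier[OF C[of k]] by simp
    moreover have "(0\<^sub>v (length (s k) + length (t' k)) :: 'a mpoly vec) = 0\<^sub>v (length (s k)) @\<^sub>v 0\<^sub>v (length (t' k))"
      by (intro eq_vecI) auto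
    ultimately have "cycle J ?e C i (u @\<^sub>v w) \<longleftrightarrow>
        (D k *\<^sub>v u + Y k *\<^sub>v w) @\<^sub>v (\<Delta> k *\<^sub>v w) = 0\<^sub>v (length (s k)) @\<^sub>v 0\<^sub>v (length (t' k))"
      using C_mult[OF uc wc] Suc by (simp add: cycle_def)
    also have "\<dots> \<longleftrightarrow> D k *\<^sub>v u + Y k *\<^sub>v w = 0\<^sub>v (length (s k)) \<and> \<Delta> k *\<^sub>v w = 0\<^sub>v (length (t' k))"
      by (rule append_vec_eq[OF add_carrier_vec[OF mult_mat_vec_carrier[OF F.D_carrier uc]
              mult_mat_vec_carrier[OF Yc wc]] zero_carrier_vec])
    also have "\<dots> \<longleftrightarrow> (\<exists>u'\<in>free_module n (length (s (Suc i))). \<exists>w'\<in>free_module n (length (t i)).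
        u = D i *\<^sub>v u' + Y i *\<^sub>v w' \<and> w = \<Delta> i *\<^sub>v w')"
    proof
      assume *: "D k *\<^sub>v u + Y k *\<^sub>v w = 0\<^sub>v (length (s k)) \<and> \<Delta> k *\<^sub>v w = 0\<^sub>v (length (t' k))"
      \<comment> \<open>For \<open>k = 0\<close> the first block puts \<open>w $ 0 * (y * g)\<close>
        into \<open>I\<close>, and \<open>colon\<close> applies. For larger \<open>k\<close> the
        second block is the cycle condition up to sign.\<close>
      have "cycle K ?e E k w"
      proof (cases k)
        case 0
        have Du: "D 0 *\<^sub>v u \<in> carrier_vec (Suc 0)"
          using uc mult_mat_vec_carrier[OF F.D_carrier[of 0]] 0 by (simp add: s0)
        have w1: "w \<in> carrier_vec (Suc 0)" "w $ 0 \<in> polys n" using wm 0 by (auto simp: free_module_iff t0)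
        have "(D 0 *\<^sub>v u) $ 0 \<in> I"
          using F.cycle_D[of u 0] u Suc 0 Du by (simp add: cycle_def e)
        moreover have "(D 0 *\<^sub>v u + Y 0 *\<^sub>v w) $ 0 = 0" using * 0 by (simp add: s0)
        then have "w $ 0 * (y * g) = - (D 0 *\<^sub>v u) $ 0"
          using Du w1 by (subst (asm) Y0) (auto simp: eq_neg_iff_add_eq_0 add.commute)
        ultimately have "w $ 0 \<in> K"
          using w1 colon[of "w $ 0"] F.uminus_mem by simp
        then show ?thesis using 0 w1 by (simp add: cycle_def e)
      next
        case (Suc j)
        then have "- (E j *\<^sub>v w) = 0\<^sub>v (length (t j))"
          using * wc by (simp add: \<Delta>_def t'_def)
        then have "- (- (E j *\<^sub>v w)) = 0\<^sub>v (length (t j))" by simp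
        then show ?thesis using Suc by (simp add: cycle_def)
      qed
      then obtain x where x: "x \<in> free_module n (length (t (Suc k)))" "w = E k *\<^sub>v x"
        using G.exact[OF wm] by blast
      have xc: "x \<in> carrier_vec (length (t (Suc k)))" using x by (simp add: free_module_iff)
      have mx: "- x \<in> free_module n (length (t (Suc k)))" using x by (auto simp: free_module_iff)
      then have mxc: "- x \<in> carrier_vec (length (t (Suc k)))" by (simp add: free_module_iff)
      have Ex: "E k *\<^sub>v - x = - w" unfolding x(2) using xc by (intro eq_vecI) auto
      have w_eq: "w = \<Delta> i *\<^sub>v - x"
        using Suc Ex mxc by (simp add: \<Delta>_def)
      \<comment> \<open>The preimage \<open>- x\<close> settles the second block. Removing its
        contribution from \<open>u\<close> leaves a cycle of \<open>D\<close>, because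
        \<open>Y k\<close> applied to \<open>E k *\<^sub>v - x = - w\<close> compensates the first
        block equation.\<close>
      let ?v = "u - Y (Suc k) *\<^sub>v - x"
      have Yx: "Y (Suc k) *\<^sub>v - x \<in> free_module n (length (s (Suc k)))"
        using mx by (intro mult_free_module[OF Y]) (simp add: t'_def)
      then have Yxc: "Y (Suc k) *\<^sub>v - x \<in> carrier_vec (length (s (Suc k)))" by (simp add: free_module_iff)
      have v: "?v \<in> free_module n (length (s (Suc k)))"
        using Yx u Suc by (auto intro: free_module_diff)
      have "D k *\<^sub>v ?v = D k *\<^sub>v u - Y k *\<^sub>v - w"
        unfolding mult_minus_distrib_mat_vec[OF F.D_carrier uc Yxc] DY[OF mxc] Ex ..
      also have "Y k *\<^sub>v - w = - (Y k *\<^sub>v w)" using wc Yc[of k] by (intro eq_vecI) auto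
      also have "D k *\<^sub>v u - - (Y k *\<^sub>v w) = D k *\<^sub>v u + Y k *\<^sub>v w"
        using Yc[of k] by (intro eq_vecI) auto
      also have "\<dots> = 0\<^sub>v (length (s k))" using * by blast
      finally have "cycle I ?e D (Suc k) ?v" by (simp add: cycle_def)
      then obtain u' where u': "u' \<in> free_module n (length (s (Suc (Suc k))))" "?v = D (Suc k) *\<^sub>v u'"
        using F.exact[OF v] by blast
      have "u = D (Suc k) *\<^sub>v u' + Y (Suc k) *\<^sub>v - x"
        unfolding u'(2)[symmetric] using uc Yxc Yc[of "Suc k"] by (intro eq_vecI) auto
      then show "\<exists>u'\<in>free_module n (length (s (Suc i))). \<exists>w'\<in>free_module n (length (t i)).
        u = D i *\<^sub>v u' + Y i *\<^sub>v w' \<and> w = \<Delta> i *\<^sub>v w'"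
        using u' mx w_eq Suc by blast
    next
      assume "\<exists>u'\<in>free_module n (length (s (Suc i))). \<exists>w'\<in>free_module n (length (t i)).
        u = D i *\<^sub>v u' + Y i *\<^sub>v w' \<and> w = \<Delta> i *\<^sub>v w'"
      then obtain u' w' where u': "u' \<in> free_module n (length (s (Suc (Suc k))))" and
        w': "w' \<in> free_module n (length (t (Suc k)))" and eq: "u = D (Suc k) *\<^sub>v u' + Y (Suc k) *\<^sub>v w'"
        and weq: "w = \<Delta> (Suc k) *\<^sub>v w'"
        using Suc by blast
      have u'c: "u' \<in> carrier_vec (length (s (Suc (Suc k))))" and w'c: "w' \<in> carrier_vec (length (t (Suc k)))"
        using u' w' by (simp_all add: free_module_iff)
      have w_eq: "w = - (E k *\<^sub>v w')" unfolding weq using w'c by (simp add: \<Delta>_def)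
      \<comment> \<open>Conversely, \<open>D\<close> kills its own boundary, and the term passing
        through \<open>Y\<close> cancels against \<open>Y k *\<^sub>v w\<close> by the sign in
        \<open>\<Delta>\<close>.\<close>
      have "D k *\<^sub>v u = D k *\<^sub>v (D (Suc k) *\<^sub>v u') + D k *\<^sub>v (Y (Suc k) *\<^sub>v w')"
        unfolding eq by (rule mult_add_distrib_mat_vec[OF F.D_carrier
              mult_mat_vec_carrier[OF F.D_carrier u'c] mult_mat_vec_carrier[OF Yc w'c]])
      also have "D k *\<^sub>v (D (Suc k) *\<^sub>v u') = 0\<^sub>v (length (s k))"
        using F.cycle_D[OF u'] by (simp add: cycle_def)
      also have "D k *\<^sub>v (Y (Suc k) *\<^sub>v w') = Y k *\<^sub>v (E k *\<^sub>v w')" by (rule DY[OF w'c])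
      finally have "D k *\<^sub>v u + Y k *\<^sub>v w = 0\<^sub>v (length (s k))"
        unfolding w_eq using Yc[of k] w'c by (intro eq_vecI) auto
      moreover have "\<Delta> k *\<^sub>v w = 0\<^sub>v (length (t' k))"
      proof (cases k)
        case 0
        then show ?thesis by (auto simp: \<Delta>_def t'_def)
      next
        case (Suc j)
        have "E j *\<^sub>v (E k *\<^sub>v w') = 0\<^sub>v (length (t j))"
          using G.cycle_D[OF w'] Suc by (simp add: cycle_def)
        then have "E j *\<^sub>v w = 0\<^sub>v (length (t j))"
          unfolding w_eq using Suc by (intro eq_vecI) (auto simp: vec_eq_iff)
        then show ?thesis using Suc wc by (simp add: \<Delta>_def t'_def)
      qed
      ultimately show "D k *\<^sub>v u + Y k *\<^sub>v w = 0\<^sub>v (length (s k)) \<and> \<Delta> k *\<^sub>v w = 0\<^sub>v (length (t' k))" ..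
    qed
    finally show ?thesis .
  qed

  have "graded_free_resolution n J (\<lambda>i. s i @ t' i) ?e C"
    unfolding graded_free_resolution_iff
  proof (intro conjI allI ballI)
    show "?e \<in> free_module n (length (s 0 @ t' 0))"
      by (simp add: s0 t'_def free_module_iff)
    fix f :: "'a mpoly" assume f: "f \<in> polys n"
    show "\<exists>v\<in>free_module n (length (s 0 @ t' 0)). f - ?e \<bullet> v \<in> J"
      using f by (intro bexI[of _ "vec 1 (\<lambda>_. f)"]) (auto simp: e s0 t'_def free_module_iff)
  next
    fix i and v :: "'a mpoly vec"
    assume "v \<in> free_module n (length (s i @ t' i))"
    then obtain u w where u: "u \<in> free_module n (length (s i))" and w: "w \<in> free_module n (length (t' i))"
      and v: "v = u @\<^sub>v w"
      using free_module_split[of v n "length (s i)" "length (t' i)"] by auto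
    have uc: "u \<in> carrier_vec (length (s i))" using u by (simp add: free_module_iff)
    have len: "length (s (Suc i) @ t' (Suc i)) = length (s (Suc i)) + length (t i)" by (simp add: t'_def)
    have "(\<exists>x\<in>free_module n (length (s (Suc i) @ t' (Suc i))). v = C i *\<^sub>v x) \<longleftrightarrow>
      (\<exists>u'\<in>free_module n (length (s (Suc i))). \<exists>w'\<in>free_module n (length (t i)).
        v = C i *\<^sub>v (u' @\<^sub>v w'))"
      unfolding len
    proof
      assume "\<exists>x\<in>free_module n (length (s (Suc i)) + length (t i)). v = C i *\<^sub>v x"
      then show "\<exists>u'\<in>free_module n (length (s (Suc i))). \<exists>w'\<in>free_module n (length (t i)).
        v = C i *\<^sub>v (u' @\<^sub>v w')"
        by (metis free_module_split)
    next
      assume "\<exists>u'\<in>free_module n (length (s (Suc i))). \<exists>w'\<in>free_module n (length (t i)).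
        v = C i *\<^sub>v (u' @\<^sub>v w')"
      then show "\<exists>x\<in>free_module n (length (s (Suc i)) + length (t i)). v = C i *\<^sub>v x"
        using free_module_append free_module_iff by metis
    qed
    also have "\<dots> \<longleftrightarrow> (\<exists>u'\<in>free_module n (length (s (Suc i))). \<exists>w'\<in>free_module n (length (t i)).
        u = D i *\<^sub>v u' + Y i *\<^sub>v w' \<and> w = \<Delta> i *\<^sub>v w')"
    proof (intro bex_cong refl)
      fix u' w' :: "'a mpoly vec" assume "u' \<in> free_module n (length (s (Suc i)))" "w' \<in> free_module n (length (t i))"
      then have c: "u' \<in> carrier_vec (length (s (Suc i)))" "w' \<in> carrier_vec (length (t i))"
        by (simp_all add: free_module_iff)
      have "D i *\<^sub>v u' + Y i *\<^sub>v w' \<in> carrier_vec (length (s i))"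
        by (rule add_carrier_vec[OF mult_mat_vec_carrier[OF F.D_carrier c(1)] mult_mat_vec_carrier[OF Yc c(2)]])
      then show "v = C i *\<^sub>v (u' @\<^sub>v w') \<longleftrightarrow> u = D i *\<^sub>v u' + Y i *\<^sub>v w' \<and> w = \<Delta> i *\<^sub>v w'"
        unfolding v C_mult[OF c] by (rule append_vec_eq[OF uc])
    qed
    finally show "cycle J ?e C i v \<longleftrightarrow> (\<exists>x\<in>free_module n (length (s (Suc i) @ t' (Suc i))). v = C i *\<^sub>v x)"
      using exact[OF u w] v by simp
  qed (use C in \<open>auto simp: s0 t'_def\<close>)
  \<comment> \<open>Minimality blockwise: \<open>D\<close> and \<open>E\<close> are minimal, and
    every entry of \<open>Y\<close> is a multiple of \<open>y\<close>.\<close>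
  moreover have "C i $$ (j, l) \<in> irrelevant_ideal n"
    if "j < length (s i @ t' i)" "l < length (s (Suc i) @ t' (Suc i))" for i j l
  proof -
    have D_irr: "D i $$ (j, l) \<in> irrelevant_ideal n" if "j < length (s i)" "l < length (s (Suc i))" for j l
      using D that by (simp add: minimal_graded_free_resolution_def)
    have E_irr: "E i $$ (j, l) \<in> irrelevant_ideal n" if "j < length (t i)" "l < length (t (Suc i))" for i j l
      using E that by (simp add: minimal_graded_free_resolution_def)
    have Y_irr: "Y i $$ (j, l) \<in> irrelevant_ideal n" if "j < length (s i)" "l < length (t i)" for j l
    proof -
      have "\<phi> i $$ (j, l) \<in> polys n" using \<phi>[of i] that by (simp add: graded_mat_def)
      then have "\<phi> i $$ (j, l) * y \<in> irrelevant_ideal n" using y by (intro irr.mult_mem)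
      then show ?thesis using \<phi>c[of i] that by (simp add: Y_def mult.commute)
    qed
    have \<Delta>_irr: "\<Delta> i $$ (j, l) \<in> irrelevant_ideal n" if "j < length (t' i)" "l < length (t i)" for j l
      using that E_irr irr.uminus_mem by (cases i) (auto simp: \<Delta>_def t'_def)
    show ?thesis
      using that D_irr Y_irr \<Delta>_irr \<Delta>c[of i] by (auto simp: C_def t'_def)
  qed
  ultimately have "minimal_graded_free_resolution n J (\<lambda>i. s i @ t' i) ?e C"
    by (simp add: minimal_graded_free_resolution_def)
  moreover have "\<forall>x\<in>set (s i @ t' i). 0 \<le> x" for i
    using I K \<open>0 \<le> a\<close> \<open>0 \<le> b\<close> by (auto simp: resolved_def t'_def split: nat.splits)
  ultimately have "resolved n J (\<lambda>i. s i @ t' i)"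
    using J s0 by (auto simp: resolved_def t'_def)
  then show ?thesis unfolding t'_def .
qed

section \<open>Path ideals\<close>

lemma times_single_eq_sum:
  fixes f :: "'a::field mpoly"
  shows "f * Poly_Mapping.single c 1
    = (\<Sum>k\<in>Poly_Mapping.keys f. Poly_Mapping.single (k + c) (Poly_Mapping.lookup f k))"
  by (subst poly_mapping_sum_singles[of f]) (simp add: sum_distrib_right mult_single)

lemma lookup_times_single:
  fixes f :: "'a::field mpoly"
  shows "Poly_Mapping.lookup (f * Poly_Mapping.single c 1) (k + c) = Poly_Mapping.lookup f k"
  unfolding times_single_eq_sum
  by (simp add: lookup_sum lookup_single when_def in_keys_iff)

text \<open>Multiplication by a monomial shifts exponents injectively, so no terms cancel and the
  colon by a monomial can be tested on each exponent.\<close>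

lemma times_single_mem_monomial_ideal:
  assumes "f \<in> polys n" "Poly_Mapping.keys c \<subseteq> {1..n}"
  shows "f * Poly_Mapping.single c 1 \<in> (monomial_ideal n M :: 'a::field mpoly set) \<longleftrightarrow>
    (\<forall>k\<in>Poly_Mapping.keys f. \<exists>m\<in>M. mdvd m (k + c))"
proof
  assume f: "f * Poly_Mapping.single c 1 \<in> (monomial_ideal n M :: 'a mpoly set)"
  show "\<forall>k\<in>Poly_Mapping.keys f. \<exists>m\<in>M. mdvd m (k + c)"
  proof
    fix k assume "k \<in> Poly_Mapping.keys f"
    then have "k + c \<in> Poly_Mapping.keys (f * Poly_Mapping.single c 1)"
      by (simp add: in_keys_iff lookup_times_single)
    from monomial_idealD[OF f this] show "\<exists>m\<in>M. mdvd m (k + c)" .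
  qed
next
  assume *: "\<forall>k\<in>Poly_Mapping.keys f. \<exists>m\<in>M. mdvd m (k + c)"
  have "\<exists>m\<in>M. mdvd m l" if "l \<in> Poly_Mapping.keys (f * Poly_Mapping.single c 1)" for l
    using that Poly_Mapping.keys_mult[of f "Poly_Mapping.single c 1"] * by fastforce
  then show "f * Poly_Mapping.single c 1 \<in> monomial_ideal n M"
    using assms by (simp add: monomial_ideal_def polys_single)
qed

lemma monomial_ideal_insert:
  fixes f :: "'a::field mpoly"
  assumes f: "f \<in> polys n" and c: "Poly_Mapping.keys c \<subseteq> {1..n}"
  shows "f \<in> monomial_ideal n (insert c M) \<longleftrightarrow>
    (\<exists>h\<in>polys n. f - h * Poly_Mapping.single c 1 \<in> monomial_ideal n M)"
proof
  assume mem: "f \<in> monomial_ideal n (insert c M)"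
  let ?A = "{k \<in> Poly_Mapping.keys f. mdvd c k}"
  \<comment> \<open>Collect the terms divisible by the monomial \<open>c\<close> and divide them by
    it; the remaining terms must be divisible by members of \<open>M\<close>.\<close>
  define h where "h = (\<Sum>k\<in>?A. Poly_Mapping.single (k - c) (Poly_Mapping.lookup f k))"
  have sub: "k - c + c = k" if "mdvd c k" for k
    using that by (intro poly_mapping_eqI) (simp add: mdvd_def lookup_add lookup_minus)
  have "Poly_Mapping.keys (k - c) \<subseteq> {1..n}" if "k \<in> ?A" for k
  proof -
    have "Poly_Mapping.keys (k - c) \<subseteq> Poly_Mapping.keys k"
      by (auto simp: in_keys_iff lookup_minus)
    also have "\<dots> \<subseteq> {1..n}" using f that unfolding polys_iff by blast
    finally show ?thesis .
  qed
  then have "h \<in> polys n" unfolding h_def by (intro polys_sum polys_single)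
  moreover have "h * Poly_Mapping.single c 1 = (\<Sum>k\<in>?A. Poly_Mapping.single k (Poly_Mapping.lookup f k))"
    by (auto simp: h_def sum_distrib_right mult_single sub intro!: sum.cong)
  then have lookup: "Poly_Mapping.lookup (f - h * Poly_Mapping.single c 1) k
      = (if mdvd c k then 0 else Poly_Mapping.lookup f k)" for k
    by (simp add: lookup_minus lookup_sum lookup_single when_def in_keys_iff)
  have "\<exists>m\<in>M. mdvd m k" if "k \<in> Poly_Mapping.keys (f - h * Poly_Mapping.single c 1)" for k
  proof -
    have "k \<in> Poly_Mapping.keys f" "\<not> mdvd c k"
      using that unfolding in_keys_iff lookup by (simp_all split: if_splits)
    then show ?thesis using monomial_idealD[OF mem] by blast
  qed
  then have "f - h * Poly_Mapping.single c 1 \<in> monomial_ideal n M"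
    using f c \<open>h \<in> polys n\<close> by (simp add: monomial_ideal_def polys_single)
  ultimately show "\<exists>h\<in>polys n. f - h * Poly_Mapping.single c 1 \<in> monomial_ideal n M" by blast
next
  interpret graded_ideal "monomial_ideal n (insert c M) :: 'a mpoly set" n
    by (rule graded_ideal_monomial_ideal)
  assume "\<exists>h\<in>polys n. f - h * Poly_Mapping.single c 1 \<in> monomial_ideal n M"
  then obtain h where h: "h \<in> polys n" "f - h * Poly_Mapping.single c 1 \<in> monomial_ideal n M" by blast
  have "f - h * Poly_Mapping.single c 1 \<in> monomial_ideal n (insert c M)"
    by (rule monomial_ideal_mono[OF h(2)]) blast
  moreover have "Poly_Mapping.single c 1 \<in> (monomial_ideal n (insert c M) :: 'a mpoly set)"
    by (rule single_mem_monomial_ideal[OF insertI1 c])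
  then have "h * Poly_Mapping.single c 1 \<in> monomial_ideal n (insert c M)"
    by (rule mult_mem[OF h(1)])
  ultimately show "f \<in> monomial_ideal n (insert c M)"
    using add_mem[of "f - h * Poly_Mapping.single c 1" "h * Poly_Mapping.single c 1"] by simp
qed

lemma mon_degree_single: "mon_degree (Poly_Mapping.single i c) = c"
  by (simp add: mon_degree_def)

text \<open>The cone with \<open>y\<close> the variable \<open>q\<close> and \<open>g\<close> the
  monomial \<open>c\<close>. By the tests above, the ideal conditions become divisibility of
  generators; the shift is the degree of the new generator.\<close>

lemma resolved_insert:
  fixes M N :: "(nat \<Rightarrow>\<^sub>0 nat) set"
  assumes M: "resolved n (monomial_ideal n M :: 'a::field mpoly set) s"
    and N: "resolved n (monomial_ideal n N :: 'a mpoly set) t"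
    and q: "q \<in> {1..n}" and c: "Poly_Mapping.keys c \<subseteq> {1..n}"
    and N_M: "\<And>m. m \<in> N \<Longrightarrow> \<exists>m'\<in>M. mdvd m' (m + c)"
    and colon: "\<And>m m'. m' \<in> M \<Longrightarrow> mdvd m' (m + (Poly_Mapping.single q 1 + c)) \<Longrightarrow> \<exists>k\<in>N. mdvd k m"
  shows "resolved n (monomial_ideal n (insert (Poly_Mapping.single q 1 + c) M) :: 'a mpoly set)
    (\<lambda>i. s i @ (case i of 0 \<Rightarrow> [] | Suc k \<Rightarrow> map ((+) (int (mon_degree c) + 1)) (t k)))"
proof (rule resolved_cone[OF M N graded_ideal_monomial_ideal, of "var q" 1 "Poly_Mapping.single c 1"])
  let ?g = "Poly_Mapping.single c 1 :: 'a mpoly"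
  have g: "var q * ?g = Poly_Mapping.single (Poly_Mapping.single q 1 + c) 1"
    by (simp add: var_def mult_single)
  have qc: "Poly_Mapping.keys (Poly_Mapping.single q 1 + c) \<subseteq> {1..n}"
    using q c by (simp add: keys_add_nat)
  show "var q \<in> irrelevant_ideal n" using q by (rule var_irrelevant)
  show "homogeneous 1 (var q)"
    using homogeneous_single[of "Poly_Mapping.single q 1" 1] by (simp add: var_def mon_degree_single)
  show "?g \<in> polys n" using c by (rule polys_single)
  show "homogeneous (int (mon_degree c)) ?g" by (rule homogeneous_single)
  show "f * ?g \<in> monomial_ideal n M" if f: "f \<in> monomial_ideal n N" for f
    unfolding times_single_mem_monomial_ideal[OF monomial_ideal_polys[OF f] c]
  proof
    fix k assume "k \<in> Poly_Mapping.keys f"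
    then obtain m where m: "m \<in> N" "mdvd m k" using monomial_idealD[OF f] by blast
    from N_M[OF m(1)] obtain m' where "m' \<in> M" "mdvd m' (m + c)" by blast
    then show "\<exists>m\<in>M. mdvd m (k + c)"
      using m(2) by (intro bexI[of _ m']) (auto simp: mdvd_def lookup_add intro: order_trans)
  qed
  show "f \<in> monomial_ideal n N" if "f \<in> polys n" "f * (var q * ?g) \<in> monomial_ideal n M" for f
  proof -
    have *: "\<forall>k\<in>Poly_Mapping.keys f. \<exists>m\<in>M. mdvd m (k + (Poly_Mapping.single q 1 + c))"
      using that(2) unfolding g times_single_mem_monomial_ideal[OF that(1) qc] .
    have "\<exists>m\<in>N. mdvd m k" if "k \<in> Poly_Mapping.keys f" for k
      using bspec[OF * that] colon by blast
    then show ?thesis using that(1) by (simp add: monomial_ideal_def)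
  qed
  show "f \<in> monomial_ideal n (insert (Poly_Mapping.single q 1 + c) M) \<longleftrightarrow>
    (\<exists>h\<in>polys n. f - h * (var q * ?g) \<in> monomial_ideal n M)" if "f \<in> polys n" for f
    unfolding g by (rule monomial_ideal_insert[OF that qc])
qed simp_all

text \<open>Without generators the ideal is zero and \<open>R\<close> resolves itself, with one
  generator of degree 0.\<close>

lemma resolved_empty:
  "resolved n (monomial_ideal n {} :: 'a::field mpoly set) (\<lambda>i. if i = 0 then [0] else [])"
proof -
  let ?s = "\<lambda>i::nat. if i = 0 then [0::int] else []"
  let ?D = "\<lambda>i. 0\<^sub>m (length (?s i)) 0 :: 'a mpoly mat"
  have zero: "monomial_ideal n {} = {0 :: 'a mpoly}"
    by (auto simp: monomial_ideal_def)
  have "graded_free_resolution n (monomial_ideal n {}) ?s (unit_vec 1 0) ?D"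
    unfolding graded_free_resolution_iff
  proof (intro conjI allI ballI)
    fix f :: "'a mpoly" assume f: "f \<in> polys n"
    have "unit_vec 1 0 \<bullet> vec 1 (\<lambda>_. f) = f" by (simp add: scalar_prod_def)
    then show "\<exists>v\<in>free_module n (length (?s 0)). f - unit_vec 1 0 \<bullet> v \<in> monomial_ideal n {}"
      using f by (intro bexI[of _ "vec 1 (\<lambda>_. f)"]) (auto simp: zero free_module_iff)
  next
    fix i and v :: "'a mpoly vec" assume v: "v \<in> free_module n (length (?s i))"
    have "?D i *\<^sub>v w = 0\<^sub>v (length (?s i))" if "w \<in> carrier_vec 0" for w
      using that by (intro eq_vecI) (auto simp: scalar_prod_def)
    then have "(\<exists>w\<in>free_module n (length (?s (Suc i))). v = ?D i *\<^sub>v w) \<longleftrightarrow> v = 0\<^sub>v (length (?s i))"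
      by (auto simp: free_module_iff intro!: exI[of _ "0\<^sub>v 0"])
    also have "\<dots> \<longleftrightarrow> cycle (monomial_ideal n {}) (unit_vec 1 0) ?D i v"
    proof (cases i)
      case 0
      then have "v \<in> carrier_vec 1" using v by (simp add: free_module_iff)
      then show ?thesis using 0 by (auto simp: cycle_def zero scalar_prod_def vec_eq_iff)
    next
      case (Suc k)
      then have "v \<in> carrier_vec 0" using v by (simp add: free_module_iff)
      then show ?thesis using Suc by (auto simp: cycle_def)
    qed
    finally show "cycle (monomial_ideal n {}) (unit_vec 1 0) ?D i v \<longleftrightarrow>
      (\<exists>w\<in>free_module n (length (?s (Suc i))). v = ?D i *\<^sub>v w)" by blast
  qed (auto simp: free_module_iff graded_mat_def)
  then have "minimal_graded_free_resolution n (monomial_ideal n {}) ?s (unit_vec 1 0) ?D"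
    by (simp add: minimal_graded_free_resolution_def)
  then show ?thesis
    using graded_ideal_monomial_ideal by (auto simp: resolved_def)
qed

section \<open>Monomials of subpaths\<close>

definition interval_monomial :: "nat \<Rightarrow> nat \<Rightarrow> nat \<Rightarrow>\<^sub>0 nat" where
  "interval_monomial i p = (\<Sum>j\<in>{i..<i + p}. Poly_Mapping.single j 1)"

lemma lookup_interval_monomial:
  "Poly_Mapping.lookup (interval_monomial i p) j = (if i \<le> j \<and> j < i + p then 1 else 0)"
  by (auto simp: interval_monomial_def lookup_sum lookup_single when_def)

lemma keys_interval_monomial: "Poly_Mapping.keys (interval_monomial i p) = {i..<i + p}"
  by (auto simp: in_keys_iff lookup_interval_monomial split: if_splits)

lemma mon_degree_interval_monomial: "mon_degree (interval_monomial i p) = p"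
  by (simp add: mon_degree_def keys_interval_monomial lookup_interval_monomial)

lemma interval_monomial_mdvd:
  "mdvd (interval_monomial i p) m \<longleftrightarrow> (\<forall>j. i \<le> j \<and> j < i + p \<longrightarrow> 0 < Poly_Mapping.lookup m j)"
  by (auto simp: mdvd_def lookup_interval_monomial Suc_le_eq)

lemma single_mdvd: "mdvd (Poly_Mapping.single q 1) m \<longleftrightarrow> 0 < Poly_Mapping.lookup m q"
  by (auto simp: mdvd_def lookup_single when_def Suc_le_eq)

lemma prod_var: "(\<Prod>j\<in>A. var j) = Poly_Mapping.single (\<Sum>j\<in>A. Poly_Mapping.single j 1) 1"
  by (induction A rule: infinite_finite_induct) (simp_all add: var_def mult_single)

definition path_monomials :: "nat \<Rightarrow> nat \<Rightarrow> (nat \<Rightarrow>\<^sub>0 nat) set" where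
  "path_monomials p k = {interval_monomial i p | i. 1 \<le> i \<and> i + p \<le> k + 1}"

lemma path_ideal_monomial:
  assumes "k \<le> n"
  shows "path_ideal n p k = monomial_ideal n (path_monomials p k)"
proof -
  have "path_ideal n p k = Idl\<^bsub>poly_ring n\<^esub> ((\<lambda>m. Poly_Mapping.single m 1) ` path_monomials p k)"
    unfolding path_ideal_def path_monomials_def prod_var interval_monomial_def[symmetric]
    by (rule arg_cong[of _ _ "genideal (poly_ring n)"]) blast
  also have "\<dots> = monomial_ideal n (path_monomials p k)"
    using assms by (intro Idl_monomials) (auto simp: path_monomials_def keys_interval_monomial)
  finally show ?thesis .
qed

text \<open>The only new subpath is the one ending at vertex \<open>k\<close>. Its last variable is
  split off to serve as the factor \<open>y\<close> of the cone.\<close>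

lemma path_monomials_insert:
  assumes "1 \<le> p" "p \<le> k"
  shows "path_monomials p k =
    insert (Poly_Mapping.single k 1 + interval_monomial (k + 1 - p) (p - 1)) (path_monomials p (k - 1))"
proof -
  have "Poly_Mapping.single k 1 + interval_monomial (k + 1 - p) (p - 1) = interval_monomial (k + 1 - p) p"
    using assms by (intro poly_mapping_eqI)
      (auto simp: lookup_add lookup_interval_monomial lookup_single when_def)
  moreover have "{i. 1 \<le> i \<and> i + p \<le> k + 1} = insert (k + 1 - p) {i. 1 \<le> i \<and> i + p \<le> k - 1 + 1}"
    using assms by auto
  ultimately show ?thesis
    unfolding path_monomials_def setcompr_eq_image by simp
qed

abbreviation shifted :: "int \<Rightarrow> (nat \<Rightarrow> int list) \<Rightarrow> nat \<Rightarrow> int list" where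
  "shifted a t i \<equiv> (case i of 0 \<Rightarrow> [] | Suc k \<Rightarrow> map ((+) a) (t k))"

section \<open>Resolutions of path ideals and the recursion\<close>

text \<open>Two cones in succession: the inner one adjoins the variable \<open>k - p\<close> to the
  ideal of the path on \<open>k - (p + 1)\<close> vertices, the outer one adjoins the last subpath
  to the ideal of the path on \<open>k - 1\<close> vertices.\<close>

lemma resolved_path_step:
  assumes p: "1 \<le> p" and k: "p + 1 \<le> k" "k \<le> n"
    and s: "resolved n (path_ideal n p (k - 1) :: 'a::field mpoly set) s"
    and t: "resolved n (path_ideal n p (k - (p + 1)) :: 'a mpoly set) t"
  shows "resolved n (path_ideal n p k :: 'a mpoly set)
    (\<lambda>i. s i @ shifted (int p) (\<lambda>i. t i @ shifted 1 t i) i)"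
proof -
  let ?J = "path_monomials p (k - (p + 1))"
  have t': "resolved n (monomial_ideal n ?J :: 'a mpoly set) t"
    using t k by (simp add: path_ideal_monomial)
  have s': "resolved n (monomial_ideal n (path_monomials p (k - 1)) :: 'a mpoly set) s"
    using s k by (simp add: path_ideal_monomial)
  \<comment> \<open>The summand \<open>0\<close> is the exponent of the monomial 1, so the cone is
    that of multiplication by a variable on \<open>R/J\<close>.\<close>
  have J_var: "resolved n (monomial_ideal n (insert (Poly_Mapping.single (k - p) 1 + 0) ?J) :: 'a mpoly set)
      (\<lambda>i. t i @ shifted (int (mon_degree 0) + 1) t i)"
  proof (rule resolved_insert[OF t' t'])
    fix m m' :: "nat \<Rightarrow>\<^sub>0 nat" assume m': "m' \<in> ?J" "mdvd m' (m + (Poly_Mapping.single (k - p) 1 + 0))"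
    then obtain i where i: "m' = interval_monomial i p" "1 \<le> i" "i + p \<le> k - (p + 1) + 1"
      by (auto simp: path_monomials_def)
    have "mdvd m' m"
      unfolding i interval_monomial_mdvd
    proof (intro allI impI)
      fix j assume j: "i \<le> j \<and> j < i + p"
      \<comment> \<open>Subpaths here end before vertex \<open>k - p\<close>, so that variable can
        be cancelled: it is a nonzerodivisor modulo the ideal.\<close>
      then have "j \<noteq> k - p" using i k by linarith
      then show "0 < Poly_Mapping.lookup m j"
        using m'(2) j unfolding i interval_monomial_mdvd by (auto simp: lookup_add lookup_single when_def)
    qed
    then show "\<exists>k\<in>?J. mdvd k m" using m' by blast
  next
    fix m assume "m \<in> ?J"
    then show "\<exists>m'\<in>?J. mdvd m' (m + 0)" by (intro bexI[of _ m]) simp_all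
  qed (use k in auto)
  have "int (mon_degree 0) + 1 = 1" by (simp add: mon_degree_def)
  note cone = resolved_insert[OF s' J_var[unfolded this add_0_right], of k "interval_monomial (k + 1 - p) (p - 1)"]
  have cone': "resolved n (monomial_ideal n (insert (Poly_Mapping.single k 1 + interval_monomial (k + 1 - p) (p - 1))
        (path_monomials p (k - 1))) :: 'a mpoly set)
      (\<lambda>i. s i @ shifted (int (mon_degree (interval_monomial (k + 1 - p) (p - 1))) + 1) (\<lambda>i. t i @ shifted 1 t i) i)"
  proof (rule cone)
    show "k \<in> {1..n}" "Poly_Mapping.keys (interval_monomial (k + 1 - p) (p - 1)) \<subseteq> {1..n}"
      using k p by (auto simp: keys_interval_monomial)
  next
    fix m assume "m \<in> insert (Poly_Mapping.single (k - p) 1) ?J"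
    then show "\<exists>m'\<in>path_monomials p (k - 1). mdvd m' (m + interval_monomial (k + 1 - p) (p - 1))"
    proof
      assume m: "m = Poly_Mapping.single (k - p) 1"
      \<comment> \<open>Prepending vertex \<open>k - p\<close> to the stretch from
        \<open>k + 1 - p\<close> to \<open>k - 1\<close> gives a full subpath of the path on
        \<open>k - 1\<close> vertices.\<close>
      have "mdvd (interval_monomial (k - p) p) (m + interval_monomial (k + 1 - p) (p - 1))"
        using k p unfolding interval_monomial_mdvd
        by (auto simp: m lookup_add lookup_single when_def lookup_interval_monomial)
      moreover have "interval_monomial (k - p) p \<in> path_monomials p (k - 1)"
        using k by (auto simp: path_monomials_def)
      ultimately show ?thesis by blast
    next
      assume "m \<in> ?J"
      then have "m \<in> path_monomials p (k - 1)" using k by (auto simp: path_monomials_def)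
      moreover have "mdvd m (m + interval_monomial (k + 1 - p) (p - 1))"
        by (simp add: mdvd_def lookup_add)
      ultimately show ?thesis by blast
    qed
  next
    fix m m' assume m': "m' \<in> path_monomials p (k - 1)"
      "mdvd m' (m + (Poly_Mapping.single k 1 + interval_monomial (k + 1 - p) (p - 1)))"
    then obtain i where i: "m' = interval_monomial i p" "1 \<le> i" "i + p \<le> k"
      using k by (auto simp: path_monomials_def)
    \<comment> \<open>The adjoined monomial only involves vertices after \<open>k - p\<close>, so
      positive exponents up to there come from \<open>m\<close> itself.\<close>
    have pos: "0 < Poly_Mapping.lookup m j" if "i \<le> j" "j < i + p" "j \<le> k - p" for j
    proof -
      have "j \<noteq> k" "\<not> k + 1 - p \<le> j" using that k p by linarith+
      then show ?thesis
        using m'(2) that unfolding i interval_monomial_mdvd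
        by (auto simp: lookup_add lookup_single when_def lookup_interval_monomial)
    qed
    show "\<exists>l\<in>insert (Poly_Mapping.single (k - p) 1) ?J. mdvd l m"
    \<comment> \<open>Either the subpath ends before vertex \<open>k - p\<close> and divides
      \<open>m\<close> entirely, or it contains that vertex, since
      \<open>i \<le> k - p\<close>.\<close>
    proof (cases "i + p \<le> k - p")
      case True
      then have "m' \<in> ?J" using i k by (auto simp: path_monomials_def)
      moreover have "mdvd m' m"
        unfolding i interval_monomial_mdvd using pos True by auto
      ultimately show ?thesis by blast
    next
      case False
      then have "mdvd (Poly_Mapping.single (k - p) 1) m"
        unfolding single_mdvd using i k by (intro pos) auto
      then show ?thesis by blast
    qed
  qed
  have deg: "int (mon_degree (interval_monomial (k + 1 - p) (p - 1))) + 1 = int p"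
    using p by (simp add: mon_degree_interval_monomial)
  have "p \<le> k" using k by simp
  from cone'[unfolded deg, folded path_monomials_insert[OF p this]] show ?thesis
    using k by (simp add: path_ideal_monomial)
qed

text \<open>Strong induction, as the step goes back by both 1 and \<open>p + 1\<close> vertices. For
  \<open>k < p\<close> the ideal is zero, for \<open>k = p\<close> it is principal.\<close>

lemma resolved_path:
  assumes p: "1 \<le> p" and "k \<le> n"
  shows "\<exists>s. resolved n (path_ideal n p k :: 'a::field mpoly set) s"
  using \<open>k \<le> n\<close>
proof (induction k rule: less_induct)
  case (less k)
  consider "k < p" | "k = p" | "p + 1 \<le> k" by linarith
  then show ?case
  proof cases
    case 1
    then have "path_monomials p k = {}" by (auto simp: path_monomials_def)
    then show ?thesis using resolved_empty less.prems by (auto simp: path_ideal_monomial)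
  next
    case 2
    then have empty: "path_monomials p (k - 1) = {}" using p by (auto simp: path_monomials_def)
    \<comment> \<open>A principal ideal is a cone on the zero ideal whose colon ideal is again
      zero.\<close>
    note base = resolved_insert[OF resolved_empty resolved_empty, of k n "interval_monomial (k + 1 - p) (p - 1)"]
    have "\<exists>s. resolved n (monomial_ideal n (path_monomials p k) :: 'a mpoly set) s"
      unfolding path_monomials_insert[OF p eq_refl[OF 2[symmetric]]] empty
      by (rule exI, rule base) (use 2 p less.prems in \<open>auto simp: keys_interval_monomial\<close>)
    then show ?thesis using less.prems by (simp add: path_ideal_monomial)
  next
    case 3
    obtain s where s: "resolved n (path_ideal n p (k - 1) :: 'a mpoly set) s"
      using less.IH[of "k - 1"] less.prems 3 by fastforce
    obtain t where t: "resolved n (path_ideal n p (k - (p + 1)) :: 'a mpoly set) t"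
      using less.IH[of "k - (p + 1)"] less.prems 3 by fastforce
    show ?thesis using resolved_path_step[OF p 3 less.prems s t] by blast
  qed
qed

text \<open>Basis degrees are nonnegative, so the count itself vanishes for negative
  \<open>d\<close> and only the sign of \<open>r\<close> needs a case distinction.\<close>

lemma graded_betti_resolved:
  assumes "resolved n I s"
  shows "graded_betti n I r d = (if r < 0 then 0 else count_list (s (nat r)) d)"
proof (cases "r < 0 \<or> d < 0")
  case True
  have "count_list (s i) d = 0" if "d < 0" for i
  proof -
    have "\<forall>x\<in>set (s i). 0 \<le> x" using assms by (simp add: resolved_def)
    then show ?thesis using that by (auto simp: count_list_0_iff)
  qed
  then show ?thesis using True by (auto simp: graded_betti_def)
next
  case False
  then show ?thesis using assms graded_betti_eq[of I n s] by (auto simp: resolved_def)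
qed

lemma count_list_shift: "count_list (map ((+) a) xs) d = count_list xs (d - a)" for a d :: int
  by (induction xs) auto

lemma count_list_shifted:
  assumes "0 \<le> r"
  shows "count_list (shifted a u (nat r)) d = (if r < 1 then 0 else count_list (u (nat (r - 1))) (d - a))"
proof (cases "r < 1")
  case False
  then have "nat r = Suc (nat (r - 1))" using assms by linarith
  then show ?thesis using False by (simp add: count_list_shift)
qed (use assms in simp)

theorem theorem3p19:
  fixes p n :: nat and r d :: int
  assumes "p \<ge> 1" and "n \<ge> p + 1"
  shows "graded_betti n (path_ideal n p n :: 'k::field mpoly set) r d =
         graded_betti n (path_ideal n p (n - 1) :: 'k mpoly set) r d
       + graded_betti n (path_ideal n p (n - (p + 1)) :: 'k mpoly set) (r - 1) (d - int p)
       + graded_betti n (path_ideal n p (n - (p + 1)) :: 'k mpoly set) (r - 2) (d - int (p + 1))"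
proof -
  obtain s where s: "resolved n (path_ideal n p (n - 1) :: 'k mpoly set) s"
    using resolved_path[OF assms(1), of "n - 1" n] by auto
  obtain t where t: "resolved n (path_ideal n p (n - (p + 1)) :: 'k mpoly set) t"
    using resolved_path[OF assms(1), of "n - (p + 1)" n] by auto
  have step: "resolved n (path_ideal n p n :: 'k mpoly set)
      (\<lambda>i. s i @ shifted (int p) (\<lambda>i. t i @ shifted 1 t i) i)"
    using resolved_path_step[OF assms order_refl s t] .
  \<comment> \<open>Counting the three parts of the list gives the summands: \<open>s\<close>, then
    \<open>t\<close> shifted once by \<open>p\<close>, then \<open>t\<close> shifted twice with
    total internal shift \<open>p + 1\<close>.\<close>
  show ?thesis
    unfolding graded_betti_resolved[OF step] graded_betti_resolved[OF s] graded_betti_resolved[OF t]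
    by (auto simp: count_list_shifted algebra_simps)
qed

end
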